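(* Let $A\in\mathbb{R}^{d\times d}$ be symmetric with $A\ge0$. Then $$WF\big(e^{-\langle\cdot,A\cdot\rangle}\big)=(\operatorname{Ker}A\setminus\{0\})\times\{0\}\subseteq T^*\mathbb{R}^d.$$
   Context: $WF$ is the Gabor wave front set of a tempered distribution on $\mathbb{R}^d$: $z_0\in T^*\mathbb{R}^d\setminus\{0\}$ is not in $WF(u)$ iff there is an open conic set $\Gamma\ni z_0$ with $\sup_{z\in\Gamma}\langle z\rangle^N|V_\varphi u(z)|<\infty$ for all $N\ge0$, where $V_\varphi u(x,\xi)=\int u(y)\overline{\varphi(y-x)}e^{-i\langle y,\xi\rangle}dy$ (pairing sense), $\varphi\in\mathscr{S}\setminus\{0\}$, $\langle z\rangle=(1+|z|^2)^{1/2}$. *)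

theory Defs
  imports "HOL-Analysis.Analysis"
begin

text \<open>Iterated directional (Frechet) derivatives along a list of directions.\<close>
fun iter_pd :: "'a::euclidean_space list \<Rightarrow> ('a \<Rightarrow> complex) \<Rightarrow> 'a \<Rightarrow> complex" where
  "iter_pd [] f = f"
| "iter_pd (v # vs) f = (\<lambda>x. frechet_derivative (iter_pd vs f) (at x) v)"

text \<open>Schwartz space: smooth functions all of whose partial derivatives decay
  faster than any power of (1 + |x|).\<close>
definition schwartz :: "('a::euclidean_space \<Rightarrow> complex) \<Rightarrow> bool" where
  "schwartz f \<longleftrightarrow>
     (\<forall>vs. set vs \<subseteq> Basis \<longrightarrow>
        (\<forall>x. iter_pd vs f differentiable (at x)) \<and>
        (\<forall>N::nat. \<exists>C. \<forall>x. (1 + norm x) ^ N * norm (iter_pd vs f x) \<le> C))"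

text \<open>Japanese bracket.\<close>
definition jbr :: "'a::real_normed_vector \<Rightarrow> real" where
  "jbr z = sqrt (1 + (norm z)\<^sup>2)"

text \<open>Short-time Fourier transform V_phi u (x, xi), for u a locally integrable function
  (here u is a bounded continuous function, regarded as a tempered distribution).\<close>
definition stft :: "('a::euclidean_space \<Rightarrow> complex) \<Rightarrow> ('a \<Rightarrow> complex) \<Rightarrow> 'a \<times> 'a \<Rightarrow> complex" where
  "stft \<phi> u z = (LINT y|lborel. u y * cnj (\<phi> (y - fst z)) * exp (- \<i> * complex_of_real (y \<bullet> snd z)))"

definition conic :: "('a::real_vector) set \<Rightarrow> bool" where
  "conic \<Gamma> \<longleftrightarrow> (\<forall>z\<in>\<Gamma>. \<forall>t::real. t > 0 \<longrightarrow> t *\<^sub>R z \<in> \<Gamma>)"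

text \<open>Gabor wave front set (with respect to the window phi).\<close>
definition gabor_WF :: "('a::euclidean_space \<Rightarrow> complex) \<Rightarrow> ('a \<Rightarrow> complex) \<Rightarrow> ('a \<times> 'a) set" where
  "gabor_WF \<phi> u = {z0. z0 \<noteq> 0 \<and>
     \<not> (\<exists>\<Gamma>. open \<Gamma> \<and> conic \<Gamma> \<and> 0 \<notin> \<Gamma> \<and> z0 \<in> \<Gamma> \<and>
           (\<forall>N::real. N \<ge> 0 \<longrightarrow> (\<exists>C. \<forall>z\<in>\<Gamma>. jbr z powr N * norm (stft \<phi> u z) \<le> C)))}"

end

theory Submission
  imports Defs "HOL-Probability.Probability"
begin

text \<open>
  Write \<open>u y = exp (- \<langle>y, A y\<rangle>)\<close> and \<open>V\<close> for its short-time Fourier transform. If \<open>\<xi> \<noteq> 0\<close>,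
  pick a coordinate vector \<open>b\<close> with \<open>\<langle>\<xi>, b\<rangle> \<noteq> 0\<close>. \<open>V(x, \<xi>)\<close> is the Fourier transform of
  \<open>u\<close> times the shifted window; the derivatives of \<open>u\<close> along \<open>b\<close> are bounded and those of the window
  are integrable. Instead of integrating by parts we apply \<open>K\<close> times the difference operator
  \<open>f \<mapsto> f - f(\<cdot> - h)\<close> with \<open>h = (\<pi> / |\<langle>\<xi>, b\<rangle>|) b\<close>: it multiplies the Fourier transform at
  \<open>\<xi>\<close> by \<open>2\<^sup>K\<close> and costs a factor \<open>(2 |h|)\<^sup>K\<close> in \<open>L\<^sup>1\<close>, so \<open>V(x, \<xi>) = O(|\<langle>\<xi>, b\<rangle>|\<^sup>-\<^sup>K)\<close>,
  which is rapid decay in the cone where \<open>|\<langle>\<xi>, b\<rangle>|\<close> dominates \<open>|(x, \<xi>)|\<close>. If \<open>A x \<noteq> 0\<close>, then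
  on the cone \<open>\<langle>x, A x\<rangle> > c |(x, \<xi>)|\<^sup>2\<close> the Gaussian is rapidly small wherever the window
  is not. Conversely, \<open>|V|\<close> is invariant under translating \<open>x\<close> along \<open>Ker A\<close> and, by injectivity of
  the Fourier transform, \<open>V(0, \<xi>) \<noteq> 0\<close> for some \<open>\<xi>\<close>; for \<open>x \<in> Ker A\<close> the points
  \<open>(t x, \<xi>)\<close> enter every conic neighbourhood of \<open>(x, 0)\<close> as \<open>t \<rightarrow> \<infinity>\<close> without any decay of \<open>V\<close>.
\<close>

section \<open>Elementary estimates\<close>

lemma power_le_fact_mult_exp:
  fixes y :: real
  assumes "0 \<le> y"
  shows "y ^ m \<le> fact m * exp y"
proof -
  have s: "summable (\<lambda>n. y ^ n /\<^sub>R fact n)"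
    using exp_converges sums_summable by blast
  have "(\<Sum>n\<in>{m}. y ^ n /\<^sub>R fact n) \<le> (\<Sum>n. y ^ n /\<^sub>R fact n)"
    by (rule sum_le_suminf[OF s]) (use assms in auto)
  also have "\<dots> = exp y"
    using exp_converges sums_unique by metis
  finally show ?thesis
    by (simp add: field_simps)
qed

lemma add_power_mult_exp_neg_le:
  fixes a x :: real
  assumes "0 \<le> a" and "0 \<le> x"
  shows "(a + x) ^ m * exp (- x) \<le> fact m * exp a"
proof -
  have "(a + x) ^ m * exp (- x) \<le> fact m * exp (a + x) * exp (- x)"
    using power_le_fact_mult_exp[of "a + x" m] assms by (intro mult_right_mono) auto
  also have "\<dots> = fact m * exp a"
    by (simp add: exp_add[symmetric] mult.assoc exp_minus_inverse)
  finally show ?thesis .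
qed

lemma abs_poly_le:
  fixes p :: "real poly"
  shows "\<bar>poly p t\<bar> \<le> (\<Sum>i\<le>degree p. \<bar>coeff p i\<bar>) * (1 + \<bar>t\<bar>) ^ degree p"
proof -
  have "\<bar>poly p t\<bar> = \<bar>\<Sum>i\<le>degree p. coeff p i * t ^ i\<bar>"
    by (simp add: poly_altdef)
  also have "\<dots> \<le> (\<Sum>i\<le>degree p. \<bar>coeff p i\<bar> * (1 + \<bar>t\<bar>) ^ degree p)"
  proof (rule order_trans[OF sum_abs], rule sum_mono)
    fix i assume "i \<in> {..degree p}"
    then have "\<bar>t\<bar> ^ i \<le> (1 + \<bar>t\<bar>) ^ degree p"
      by (intro order_trans[OF power_mono power_increasing]) auto
    then show "\<bar>coeff p i * t ^ i\<bar> \<le> \<bar>coeff p i\<bar> * (1 + \<bar>t\<bar>) ^ degree p"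
      by (simp add: abs_mult power_abs mult_left_mono)
  qed
  also have "\<dots> = (\<Sum>i\<le>degree p. \<bar>coeff p i\<bar>) * (1 + \<bar>t\<bar>) ^ degree p"
    by (simp add: sum_distrib_right)
  finally show ?thesis .
qed

lemma uniform_bound_upto:
  fixes f :: "nat \<Rightarrow> 'a \<Rightarrow> real"
  assumes "\<And>j. \<exists>C. \<forall>y. f j y \<le> C"
  shows "\<exists>C. 0 \<le> C \<and> (\<forall>j\<le>K. \<forall>y. f j y \<le> C)"
proof -
  obtain C where C: "\<And>j y. f j y \<le> C j"
    using assms by metis
  have "f j y \<le> max 0 (Max (C ` {..K}))" if "j \<le> K" for j y
    using that by (intro order_trans[OF C] max.coboundedI2 Max_ge) auto
  then show ?thesis
    by (intro exI[of _ "max 0 (Max (C ` {..K}))"]) auto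
qed

lemma one_plus_square_power_le:
  fixes n :: real
  assumes "1 \<le> n"
  shows "(1 + n\<^sup>2) ^ K \<le> 2 ^ K * n ^ (2 * K)"
proof -
  have "(1 + n\<^sup>2) ^ K \<le> (2 * n\<^sup>2) ^ K"
    using assms by (intro power_mono) (auto simp: power2_eq_square intro: order_trans[OF _ mult_right_mono[of 1]])
  then show ?thesis
    by (simp add: power_mult_distrib power_mult)
qed

section \<open>Lebesgue integrals on Euclidean spaces\<close>

lemma lborel_integral_translate:
  fixes f :: "'a::euclidean_space \<Rightarrow> 'b::{banach,second_countable_topology}"
  assumes [measurable]: "f \<in> borel_measurable borel"
  shows "(\<integral>y. f (y + c) \<partial>lborel) = (\<integral>y. f y \<partial>lborel)"
proof -
  have "(\<integral>y. f y \<partial>lborel) = (\<integral>y. f y \<partial>distr lborel borel ((+) c))"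
    by (simp add: lborel_distr_plus)
  also have "\<dots> = (\<integral>y. f (c + y) \<partial>lborel)"
    by (rule integral_distr) auto
  finally show ?thesis
    by (simp add: add.commute)
qed

lemma integrable_lborel_translate_iff:
  fixes f :: "'a::euclidean_space \<Rightarrow> 'b::{banach,second_countable_topology}"
  assumes [measurable]: "f \<in> borel_measurable borel"
  shows "integrable lborel (\<lambda>y. f (y + c)) \<longleftrightarrow> integrable lborel f"
proof -
  have "integrable lborel f \<longleftrightarrow> integrable (distr lborel borel ((+) c)) f"
    by (simp add: lborel_distr_plus)
  also have "\<dots> \<longleftrightarrow> integrable lborel (\<lambda>y. f (c + y))"
    by (rule integrable_distr_eq) auto
  finally show ?thesis
    by (simp add: add.commute)
qed

lemma lborel_nn_integral_translate:
  fixes f :: "'a::euclidean_space \<Rightarrow> ennreal"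
  assumes [measurable]: "f \<in> borel_measurable borel"
  shows "(\<integral>\<^sup>+y. f (y + c) \<partial>lborel) = (\<integral>\<^sup>+y. f y \<partial>lborel)"
proof -
  have "(\<integral>\<^sup>+y. f y \<partial>lborel) = (\<integral>\<^sup>+y. f y \<partial>distr lborel borel ((+) c))"
    by (simp add: lborel_distr_plus)
  also have "\<dots> = (\<integral>\<^sup>+y. f (c + y) \<partial>lborel)"
    by (rule nn_integral_distr) auto
  finally show ?thesis
    by (simp add: add.commute)
qed

lemma lborel_nn_integral_norm_translate:
  fixes f :: "'a::euclidean_space \<Rightarrow> 'b::{banach,second_countable_topology}"
  assumes [measurable]: "f \<in> borel_measurable borel"
  shows "(\<integral>\<^sup>+y. norm (f (y - h)) \<partial>lborel) = (\<integral>\<^sup>+y. norm (f y) \<partial>lborel)"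
  using lborel_nn_integral_translate[where f="\<lambda>y. ennreal (norm (f y))" and c="- h"] by simp

lemma nn_integral_norm_add_le:
  fixes f g :: "'a \<Rightarrow> 'b::{banach,second_countable_topology}"
  assumes [measurable]: "f \<in> borel_measurable M" "g \<in> borel_measurable M"
  shows "(\<integral>\<^sup>+y. norm (f y + g y) \<partial>M) \<le> (\<integral>\<^sup>+y. norm (f y) \<partial>M) + (\<integral>\<^sup>+y. norm (g y) \<partial>M)"
proof -
  have "(\<integral>\<^sup>+y. norm (f y + g y) \<partial>M) \<le> (\<integral>\<^sup>+y. ennreal (norm (f y)) + ennreal (norm (g y)) \<partial>M)"
    by (intro nn_integral_mono) (simp add: ennreal_plus[symmetric] norm_triangle_ineq del: ennreal_plus)
  also have "\<dots> = (\<integral>\<^sup>+y. norm (f y) \<partial>M) + (\<integral>\<^sup>+y. norm (g y) \<partial>M)"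
    by (rule nn_integral_add) auto
  finally show ?thesis .
qed

lemma nn_integral_norm_mult_le:
  fixes f g :: "'a \<Rightarrow> 'b::{real_normed_div_algebra,banach,second_countable_topology}"
  assumes [measurable]: "g \<in> borel_measurable M" and "\<And>y. norm (f y) \<le> C" and "0 \<le> C"
  shows "(\<integral>\<^sup>+y. norm (f y * g y) \<partial>M) \<le> ennreal C * (\<integral>\<^sup>+y. norm (g y) \<partial>M)"
proof -
  have "(\<integral>\<^sup>+y. norm (f y * g y) \<partial>M) \<le> (\<integral>\<^sup>+y. ennreal C * norm (g y) \<partial>M)"
    using assms by (intro nn_integral_mono)
      (simp add: norm_mult mult_right_mono ennreal_mult[symmetric] ennreal_leI)
  also have "\<dots> = ennreal C * (\<integral>\<^sup>+y. norm (g y) \<partial>M)"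
    by (rule nn_integral_cmult) measurable
  finally show ?thesis .
qed

lemma lborel_integral_affine:
  fixes f :: "'a::euclidean_space \<Rightarrow> 'b::{banach,second_countable_topology}"
  assumes [measurable]: "f \<in> borel_measurable borel" and "c \<noteq> 0"
  shows "(\<integral>x. f x \<partial>lborel) = \<bar>c\<bar> ^ DIM('a) *\<^sub>R (\<integral>x. f (t + c *\<^sub>R x) \<partial>lborel)"
proof -
  have "(\<integral>x. f x \<partial>lborel)
      = (\<integral>x. f x \<partial>density (distr lborel borel (\<lambda>x. t + c *\<^sub>R x)) (\<lambda>_. \<bar>c\<bar> ^ DIM('a)))"
    by (simp only: lborel_affine[OF \<open>c \<noteq> 0\<close>, of t, symmetric])
  also have "\<dots> = (\<integral>x. \<bar>c\<bar> ^ DIM('a) *\<^sub>R f x \<partial>distr lborel borel (\<lambda>x. t + c *\<^sub>R x))"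
    by (rule integral_density) auto
  also have "\<dots> = (\<integral>x. \<bar>c\<bar> ^ DIM('a) *\<^sub>R f (t + c *\<^sub>R x) \<partial>lborel)"
    by (rule integral_distr) auto
  finally show ?thesis
    by simp
qed

lemma norm_integral_le_of_nn_integral_le:
  fixes g :: "'a \<Rightarrow> 'b::{banach,second_countable_topology}"
  assumes "integrable M g" and "(\<integral>\<^sup>+y. norm (g y) \<partial>M) \<le> ennreal B" and "0 \<le> B"
  shows "norm (\<integral>y. g y \<partial>M) \<le> B"
proof -
  have "ennreal (\<integral>y. norm (g y) \<partial>M) = (\<integral>\<^sup>+y. norm (g y) \<partial>M)"
    by (rule nn_integral_eq_integral[symmetric]) (use assms in auto)
  then have "ennreal (\<integral>y. norm (g y) \<partial>M) \<le> ennreal B"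
    using assms by simp
  then have "(\<integral>y. norm (g y) \<partial>M) \<le> B"
    using ennreal_le_iff[OF \<open>0 \<le> B\<close>] by blast
  then show ?thesis
    using integral_norm_bound order_trans by blast
qed

lemma
  fixes f :: "'a::euclidean_space \<Rightarrow> real \<Rightarrow> 'c::{real_normed_field,banach,second_countable_topology}"
  assumes int: "\<And>b. b \<in> Basis \<Longrightarrow> integrable lborel (f b)"
  shows integrable_lborel_prod_coords: "integrable lborel (\<lambda>v::'a. \<Prod>b\<in>Basis. f b (v \<bullet> b))"
    and integral_lborel_prod_coords:
      "(\<integral>v. (\<Prod>b\<in>Basis. f b (v \<bullet> b)) \<partial>lborel) = (\<Prod>b\<in>Basis. \<integral>t. f b t \<partial>lborel)"
proof -
  interpret P: product_sigma_finite "\<lambda>_::'a. lborel :: real measure"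
    by (simp add: product_sigma_finite_def sigma_finite_lborel)
  define T where "T = (\<lambda>g::'a \<Rightarrow> real. \<Sum>b\<in>Basis. g b *\<^sub>R b)"
  have [measurable]: "f b \<in> borel_measurable borel" if "b \<in> Basis" for b
    using int[OF that] by auto
  have mF: "(\<lambda>v::'a. \<Prod>b\<in>Basis. f b (v \<bullet> b)) \<in> borel_measurable borel"
    by (intro borel_measurable_prod) measurable
  have eqF: "(\<lambda>g. \<Prod>b\<in>Basis. f b (T g \<bullet> b)) = (\<lambda>g. \<Prod>b\<in>Basis. f b (g b))"
    by (intro ext prod.cong) (auto simp: T_def inner_sum_left inner_Basis if_distrib cong: if_cong)
  have mT: "T \<in> (\<Pi>\<^sub>M b\<in>(Basis::'a set). (lborel::real measure)) \<rightarrow>\<^sub>M borel"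
    unfolding T_def by measurable
  have lb: "lborel = distr (\<Pi>\<^sub>M b\<in>(Basis::'a set). (lborel::real measure)) borel T"
    unfolding T_def by (rule lborel_eq)
  have "integrable (distr (\<Pi>\<^sub>M b\<in>(Basis::'a set). (lborel::real measure)) borel T)
      (\<lambda>v::'a. \<Prod>b\<in>Basis. f b (v \<bullet> b))"
    by (subst integrable_distr_eq[OF mT mF]) (simp add: eqF P.product_integrable_prod int)
  then show "integrable lborel (\<lambda>v::'a. \<Prod>b\<in>Basis. f b (v \<bullet> b))"
    by (simp only: lb)
  have "(\<integral>v. (\<Prod>b\<in>Basis. f b (v \<bullet> b)) \<partial>lborel)
      = (\<integral>g. (\<Prod>b\<in>Basis. f b (T g \<bullet> b)) \<partial>(\<Pi>\<^sub>M b\<in>(Basis::'a set). (lborel::real measure)))"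
    by (simp only: lb integral_distr[OF mT mF])
  also have "\<dots> = (\<Prod>b\<in>Basis. \<integral>t. f b t \<partial>lborel)"
    unfolding eqF by (rule P.product_integral_prod) (auto intro: int)
  finally show "(\<integral>v. (\<Prod>b\<in>Basis. f b (v \<bullet> b)) \<partial>lborel) = (\<Prod>b\<in>Basis. \<integral>t. f b t \<partial>lborel)" .
qed

lemma integrable_inverse_one_plus_norm_square_power:
  "integrable lborel (\<lambda>y::'a::euclidean_space. 1 / (1 + (norm y)\<^sup>2) ^ DIM('a))"
proof -
  have "integrable lborel (\<lambda>t::real. 1 / (1 + t\<^sup>2))"
    using integrable_inverse_1_plus_square
    by (simp add: set_integrable_def einterval_def divide_inverse)
  then have "integrable lborel (\<lambda>y::'a. \<Prod>b\<in>Basis. 1 / (1 + (y \<bullet> b)\<^sup>2))"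
    using integrable_lborel_prod_coords[where f="\<lambda>_ t. 1 / (1 + t\<^sup>2)"] by simp
  then show ?thesis
  proof (rule Bochner_Integration.integrable_bound)
    show "(\<lambda>y::'a. 1 / (1 + (norm y)\<^sup>2) ^ DIM('a)) \<in> borel_measurable lborel"
      by measurable
    show "AE y::'a in lborel. norm (1 / (1 + (norm y)\<^sup>2) ^ DIM('a)) \<le> norm (\<Prod>b\<in>Basis. 1 / (1 + (y \<bullet> b)\<^sup>2))"
    proof (intro AE_I2)
      fix y :: 'a
      have "(\<Prod>b\<in>Basis. 1 + (y \<bullet> b)\<^sup>2) \<le> (\<Prod>b\<in>(Basis::'a set). 1 + (norm y)\<^sup>2)"
      proof (intro prod_mono conjI)
        fix b :: 'a assume "b \<in> Basis"
        then have "\<bar>y \<bullet> b\<bar> \<le> \<bar>norm y\<bar>" by (simp add: Basis_le_norm)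
        then have "(y \<bullet> b)\<^sup>2 \<le> (norm y)\<^sup>2" by (simp only: abs_le_square_iff)
        then show "1 + (y \<bullet> b)\<^sup>2 \<le> 1 + (norm y)\<^sup>2" by simp
      qed (auto intro: add_nonneg_nonneg)
      moreover have "0 < (\<Prod>b\<in>(Basis::'a set). 1 + (y \<bullet> b)\<^sup>2)"
        by (intro prod_pos) (auto intro: add_pos_nonneg)
      ultimately have "1 / (1 + (norm y)\<^sup>2) ^ DIM('a) \<le> 1 / (\<Prod>b\<in>Basis. 1 + (y \<bullet> b)\<^sup>2)"
        by (intro divide_left_mono) (auto simp: prod_constant)
      then show "norm (1 / (1 + (norm y)\<^sup>2) ^ DIM('a)) \<le> norm (\<Prod>b\<in>Basis. 1 / (1 + (y \<bullet> b)\<^sup>2))"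
        by (simp add: prod_dividef abs_of_nonneg prod_nonneg)
    qed
  qed
qed

lemma measurable_pair_lborel_of_borel:
  assumes "f \<in> borel_measurable (borel :: ('a::euclidean_space \<times> 'b::euclidean_space) measure)"
  shows "f \<in> borel_measurable ((lborel::'a measure) \<Otimes>\<^sub>M (lborel::'b measure))"
proof -
  have "sets ((lborel::'a measure) \<Otimes>\<^sub>M (lborel::'b measure)) = sets ((borel::'a measure) \<Otimes>\<^sub>M (borel::'b measure))"
    by (rule sets_pair_measure_cong) auto
  also have "\<dots> = sets (borel :: ('a \<times> 'b) measure)"
    by (simp only: borel_prod)
  finally show ?thesis
    using assms measurable_cong_sets by blast
qed

lemma integrable_pair_lborel_mult:
  fixes f :: "'a::euclidean_space \<Rightarrow> real" and g :: "'b::euclidean_space \<Rightarrow> real"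
  assumes f: "integrable lborel f" and g: "integrable lborel g"
  shows "integrable (lborel \<Otimes>\<^sub>M lborel) (\<lambda>(x, y). f x * g y)"
proof -
  have [measurable]: "f \<in> borel_measurable borel" "g \<in> borel_measurable borel"
    using f g by auto
  have "(\<integral>\<^sup>+z. ennreal (norm ((\<lambda>(x, y). f x * g y) z)) \<partial>(lborel \<Otimes>\<^sub>M lborel))
      = (\<integral>\<^sup>+x. \<integral>\<^sup>+y. ennreal (norm (f x)) * ennreal (norm (g y)) \<partial>(lborel::'b measure) \<partial>(lborel::'a measure))"
    by (subst sigma_finite_measure.nn_integral_fst[OF sigma_finite_lborel, symmetric])
      (auto simp: abs_mult ennreal_mult)
  also have "\<dots> = (\<integral>\<^sup>+x. ennreal (norm (f x)) * (\<integral>\<^sup>+y. ennreal (norm (g y)) \<partial>lborel) \<partial>lborel)"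
    by (intro nn_integral_cong nn_integral_cmult) auto
  also have "\<dots> = (\<integral>\<^sup>+x. ennreal (norm (f x)) \<partial>lborel) * (\<integral>\<^sup>+y. ennreal (norm (g y)) \<partial>lborel)"
    by (rule nn_integral_multc) auto
  also have "\<dots> < \<infinity>"
    using f g by (simp add: integrable_iff_bounded ennreal_mult_less_top)
  finally show ?thesis
    unfolding integrable_iff_bounded by auto
qed

section \<open>Schwartz functions\<close>

lemma schwartz_iter_pd_differentiable:
  "schwartz f \<Longrightarrow> set vs \<subseteq> Basis \<Longrightarrow> iter_pd vs f differentiable (at x)"
  by (simp add: schwartz_def)

lemma schwartz_iter_pd_continuous_on:
  "schwartz f \<Longrightarrow> set vs \<subseteq> Basis \<Longrightarrow> continuous_on S (iter_pd vs f)"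
  by (meson continuous_at_imp_continuous_on differentiable_imp_continuous_within
      schwartz_iter_pd_differentiable)

lemma schwartz_iter_pd_measurable:
  "schwartz f \<Longrightarrow> set vs \<subseteq> Basis \<Longrightarrow> iter_pd vs f \<in> borel_measurable borel"
  by (intro borel_measurable_continuous_onI schwartz_iter_pd_continuous_on)

lemma schwartz_iter_pd_bound:
  "schwartz f \<Longrightarrow> set vs \<subseteq> Basis \<Longrightarrow> \<exists>C. \<forall>x. (1 + norm x) ^ N * norm (iter_pd vs f x) \<le> C"
  by (simp add: schwartz_def)

lemma integrable_schwartz_iter_pd_weighted:
  fixes f :: "'a::euclidean_space \<Rightarrow> complex"
  assumes f: "schwartz f" and vs: "set vs \<subseteq> Basis"
  shows "integrable lborel (\<lambda>y. (1 + (norm y)\<^sup>2) ^ k * norm (iter_pd vs f y))"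
proof -
  obtain C where C: "\<And>x. (1 + norm x) ^ (2 * (k + DIM('a))) * norm (iter_pd vs f x) \<le> C"
    using schwartz_iter_pd_bound[OF f vs] by blast
  have [measurable]: "iter_pd vs f \<in> borel_measurable borel"
    by (rule schwartz_iter_pd_measurable[OF f vs])
  show ?thesis
  proof (rule Bochner_Integration.integrable_bound[OF
        integrable_mult_right[OF integrable_inverse_one_plus_norm_square_power, of C]])
    show "(\<lambda>y. (1 + (norm y)\<^sup>2) ^ k * norm (iter_pd vs f y)) \<in> borel_measurable lborel"
      by simp
    show "AE x in lborel. norm ((1 + (norm x)\<^sup>2) ^ k * norm (iter_pd vs f x))
        \<le> norm (C * (1 / (1 + (norm x)\<^sup>2) ^ DIM('a)))"
    proof (intro AE_I2)
      fix x :: 'a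
      have "1 + (norm x)\<^sup>2 \<le> (1 + norm x)\<^sup>2"
        by (simp add: power2_eq_square algebra_simps)
      then have "(1 + (norm x)\<^sup>2) ^ (k + DIM('a)) \<le> (1 + norm x) ^ (2 * (k + DIM('a)))"
        by (simp only: power_mult) (intro power_mono, auto)
      then have "(1 + (norm x)\<^sup>2) ^ k * norm (iter_pd vs f x) * (1 + (norm x)\<^sup>2) ^ DIM('a) \<le> C"
        using C[of x] by (smt (verit) mult.assoc mult.commute mult_right_mono norm_ge_zero power_add)
      moreover have "0 < (1 + (norm x)\<^sup>2) ^ DIM('a)"
        by (intro zero_less_power) (auto intro: add_pos_nonneg)
      ultimately show "norm ((1 + (norm x)\<^sup>2) ^ k * norm (iter_pd vs f x))
          \<le> norm (C * (1 / (1 + (norm x)\<^sup>2) ^ DIM('a)))"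
        by (simp add: field_simps)
    qed
  qed
qed

lemma schwartz_continuous_on: "schwartz f \<Longrightarrow> continuous_on S f"
  using schwartz_iter_pd_continuous_on[of f "[]"] by simp

lemma schwartz_measurable: "schwartz f \<Longrightarrow> f \<in> borel_measurable borel"
  by (intro borel_measurable_continuous_onI schwartz_continuous_on)

lemma integrable_schwartz:
  fixes f :: "'a::euclidean_space \<Rightarrow> complex"
  assumes "schwartz f"
  shows "integrable lborel f"
proof -
  have "integrable lborel (\<lambda>y. norm (f y))"
    using integrable_schwartz_iter_pd_weighted[OF assms, of "[]" 0] by simp
  then show ?thesis
    using schwartz_measurable[OF assms] by (subst integrable_norm_iff[symmetric]) auto
qed

lemma schwartz_bounded: "schwartz f \<Longrightarrow> \<exists>C. \<forall>y. norm (f y) \<le> C"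
  using schwartz_iter_pd_bound[of f "[]" 0] by simp

section \<open>Positive semidefinite quadratic forms\<close>

locale psd_matrix =
  fixes A :: "real^'n^'n"
  assumes symmetric: "transpose A = A"
    and nonneg: "\<forall>x. 0 \<le> x \<bullet> (A *v x)"
begin

definition qf :: "real^'n \<Rightarrow> real" where
  "qf x = x \<bullet> (A *v x)"

definition bf :: "real^'n \<Rightarrow> real^'n \<Rightarrow> real" where
  "bf x y = x \<bullet> (A *v y)"

lemma bf_commute: "bf x y = bf y x"
proof -
  have "x \<bullet> (A *v y) = (transpose A *v x) \<bullet> y"
    by (simp add: dot_lmul_matrix[symmetric])
  then show ?thesis
    by (simp add: bf_def symmetric inner_commute)
qed

lemma qf_nonneg: "0 \<le> qf x"
  using nonneg by (simp add: qf_def)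

lemma qf_add: "qf (x + y) = qf x + 2 * bf x y + qf y"
  using bf_commute[of y x]
  by (simp add: qf_def bf_def matrix_vector_right_distrib inner_add_left inner_add_right)

lemma qf_scaleR: "qf (c *\<^sub>R x) = c\<^sup>2 * qf x"
  by (simp add: qf_def matrix_vector_mult_scaleR power2_eq_square)

lemma bf_scaleR_right: "bf x (c *\<^sub>R y) = c * bf x y"
  by (simp add: bf_def matrix_vector_mult_scaleR)

lemma qf_add_le: "qf (x + y) \<le> 2 * qf x + 2 * qf y"
proof -
  have "qf (x - y) = qf x - 2 * bf x y + qf y"
    using qf_add[of x "- y"] by (simp add: qf_def bf_def vec.neg)
  then show ?thesis
    using qf_add[of x y] qf_nonneg[of "x - y"] by linarith
qed

lemma bf_square_le: "(bf x y)\<^sup>2 \<le> qf x * qf y"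
proof (cases "qf y = 0")
  case True
  have "bf x y = 0"
  proof (rule ccontr)
    assume ne: "bf x y \<noteq> 0"
    have "0 \<le> qf (x + (- (qf x + 1) / (2 * bf x y)) *\<^sub>R y)"
      by (rule qf_nonneg)
    also have "\<dots> = -1"
      using ne True by (simp add: qf_add bf_scaleR_right qf_scaleR field_simps)
    finally show False
      by simp
  qed
  then show ?thesis
    using True by simp
next
  case False
  then have qy: "qf y > 0"
    using qf_nonneg[of y] by simp
  define t where "t = - bf x y / qf y"
  have "0 \<le> qf (x + t *\<^sub>R y)"
    by (rule qf_nonneg)
  also have "\<dots> = qf x + 2 * t * bf x y + t\<^sup>2 * qf y"
    by (simp add: qf_add bf_scaleR_right qf_scaleR)
  also have "\<dots> = qf x - (bf x y)\<^sup>2 / qf y"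
    using qy by (simp add: t_def field_simps power2_eq_square)
  finally show ?thesis
    using qy by (simp add: field_simps)
qed

lemma qf_eq_0_imp_kernel:
  assumes "qf x = 0"
  shows "A *v x = 0"
proof -
  have "bf x (A *v x) = (A *v x) \<bullet> (A *v x)"
    using bf_commute[of x "A *v x"] by (simp add: bf_def inner_commute)
  moreover have "(bf x (A *v x))\<^sup>2 \<le> 0"
    using bf_square_le[of x "A *v x"] assms by simp
  ultimately show ?thesis
    by simp
qed

lemma qf_pos_off_kernel: "A *v x \<noteq> 0 \<Longrightarrow> qf x > 0"
  using qf_eq_0_imp_kernel qf_nonneg[of x] by force

lemma qf_add_kernel: "A *v x = 0 \<Longrightarrow> qf (y + x) = qf y"
  using qf_add[of y x] by (simp add: bf_def qf_def)

lemma qf_le_onorm: "qf x \<le> onorm ((*v) A) * (norm x)\<^sup>2"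
proof -
  have "qf x \<le> norm x * norm (A *v x)"
    unfolding qf_def by (rule order_trans[OF _ norm_cauchy_schwarz]) simp
  also have "\<dots> \<le> norm x * (onorm ((*v) A) * norm x)"
    by (intro mult_left_mono onorm) auto
  finally show ?thesis
    by (simp add: power2_eq_square mult_ac)
qed

lemma continuous_on_qf [continuous_intros]: "continuous_on S qf"
  unfolding qf_def by (intro continuous_intros linear_continuous_on) auto

text \<open>Since \<open>qf x \<le> 2 qf y + 2 qf (x - y)\<close>, the weight \<open>(1 + Z)\<^sup>K\<close> is bounded by a polynomial in
  \<open>qf y\<close>, which \<open>exp (- qf y)\<close> absorbs, times a polynomial in \<open>|y - x|\<close>.\<close>

lemma cone_weight_mult_exp_le:
  assumes "0 < c" and "0 \<le> Z" and cone: "c * Z \<le> qf x"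
  shows "(1 + Z) ^ K * exp (- qf y)
    \<le> (2 / c) ^ K * (fact K * exp (c / 2)) * (1 + 2 / c * onorm ((*v) A)) ^ K * (1 + (norm (y - x))\<^sup>2) ^ K"
proof -
  define \<kappa> B Q W where "\<kappa> = 2 / c" and "B = onorm ((*v) A)" and "Q = qf y" and "W = (norm (y - x))\<^sup>2"
  have "0 \<le> B"
    unfolding B_def by (intro onorm_pos_le) auto
  have "0 < \<kappa>" "0 \<le> Q" "0 \<le> W"
    using \<open>0 < c\<close> by (simp_all add: \<kappa>_def Q_def W_def qf_nonneg)
  have "qf x \<le> 2 * qf y + 2 * qf (x - y)"
    using qf_add_le[of y "x - y"] by simp
  moreover have "qf (x - y) \<le> B * W"
    using qf_le_onorm[of "x - y"] by (simp add: B_def W_def norm_minus_commute)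
  ultimately have "Z \<le> \<kappa> * Q + \<kappa> * B * W"
    using cone \<open>0 < c\<close> by (simp add: \<kappa>_def Q_def field_simps)
  moreover have "0 \<le> (\<kappa> * Q) * (\<kappa> * B * W)"
    using \<open>0 < \<kappa>\<close> \<open>0 \<le> B\<close> \<open>0 \<le> Q\<close> \<open>0 \<le> W\<close> by simp
  ultimately have "1 + Z \<le> (1 + \<kappa> * Q) * (1 + \<kappa> * B * W)"
    by (simp add: algebra_simps)
  also have "\<dots> \<le> (1 + \<kappa> * Q) * ((1 + \<kappa> * B) * (1 + W))"
    using \<open>0 < \<kappa>\<close> \<open>0 \<le> B\<close> \<open>0 \<le> Q\<close> \<open>0 \<le> W\<close> by (intro mult_left_mono) (auto simp: algebra_simps)
  finally have "(1 + Z) ^ K \<le> ((1 + \<kappa> * Q) * ((1 + \<kappa> * B) * (1 + W))) ^ K"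
    using \<open>0 \<le> Z\<close> by (intro power_mono) auto
  then have "(1 + Z) ^ K * exp (- Q) \<le> ((1 + \<kappa> * Q) ^ K * exp (- Q)) * ((1 + \<kappa> * B) ^ K * (1 + W) ^ K)"
    by (simp add: power_mult_distrib mult_ac)
  also have "\<dots> \<le> (\<kappa> ^ K * (fact K * exp (c / 2))) * ((1 + \<kappa> * B) ^ K * (1 + W) ^ K)"
  proof (rule mult_right_mono)
    have "1 + \<kappa> * Q = \<kappa> * (c / 2 + Q)"
      using \<open>0 < c\<close> by (simp add: \<kappa>_def field_simps)
    then have "(1 + \<kappa> * Q) ^ K * exp (- Q) = \<kappa> ^ K * ((c / 2 + Q) ^ K * exp (- Q))"
      by (simp add: power_mult_distrib)
    also have "\<dots> \<le> \<kappa> ^ K * (fact K * exp (c / 2))"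
      using \<open>0 < c\<close> \<open>0 < \<kappa>\<close> \<open>0 \<le> Q\<close> by (intro mult_left_mono add_power_mult_exp_neg_le) auto
    finally show "(1 + \<kappa> * Q) ^ K * exp (- Q) \<le> \<kappa> ^ K * (fact K * exp (c / 2))" .
  qed (use \<open>0 < \<kappa>\<close> \<open>0 \<le> B\<close> \<open>0 \<le> W\<close> in simp)
  finally show ?thesis
    by (simp add: \<kappa>_def B_def Q_def W_def mult_ac)
qed

end

section \<open>Finite differences along a derivative chain\<close>

definition dir_deriv_chain :: "'a::euclidean_space \<Rightarrow> (nat \<Rightarrow> 'a \<Rightarrow> complex) \<Rightarrow> bool" where
  "dir_deriv_chain b F \<longleftrightarrow>
     (\<forall>j y t. ((\<lambda>s. F j (y + s *\<^sub>R b)) has_vector_derivative F (Suc j) (y + t *\<^sub>R b)) (at t))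
     \<and> (\<forall>j. continuous_on UNIV (F j))"

lemma dir_deriv_chainI:
  assumes "\<And>j y. ((\<lambda>s. F j (y + s *\<^sub>R b)) has_vector_derivative F (Suc j) y) (at 0)"
    and "\<And>j. continuous_on UNIV (F j)"
  shows "dir_deriv_chain b F"
  unfolding dir_deriv_chain_def
proof (intro conjI allI)
  fix j y t
  have "((\<lambda>s. s - t) has_vector_derivative 1) (at t)"
    by (auto intro!: derivative_eq_intros)
  then have "((\<lambda>s. F j ((y + t *\<^sub>R b) + s *\<^sub>R b)) \<circ> (\<lambda>s. s - t) has_vector_derivative
      1 *\<^sub>R F (Suc j) (y + t *\<^sub>R b)) (at t)"
    using assms(1)[of j "y + t *\<^sub>R b"] by (intro vector_diff_chain_at) auto
  moreover have "(\<lambda>s. F j ((y + t *\<^sub>R b) + s *\<^sub>R b)) \<circ> (\<lambda>s. s - t) = (\<lambda>s. F j (y + s *\<^sub>R b))"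
    by (auto simp: algebra_simps)
  ultimately show "((\<lambda>s. F j (y + s *\<^sub>R b)) has_vector_derivative F (Suc j) (y + t *\<^sub>R b)) (at t)"
    by simp
qed (use assms in auto)

lemma dir_deriv_chain_continuous_on: "dir_deriv_chain b F \<Longrightarrow> continuous_on UNIV (F j)"
  by (simp add: dir_deriv_chain_def)

lemma dir_deriv_chain_has_integral:
  assumes "dir_deriv_chain b F" and "0 < r"
  shows "((\<lambda>s. F (Suc j) (y + s *\<^sub>R b)) has_integral (F j y - F j (y - r *\<^sub>R b))) {-r..0}"
  using fundamental_theorem_of_calculus[of "-r" 0 "\<lambda>s. F j (y + s *\<^sub>R b)" "\<lambda>s. F (Suc j) (y + s *\<^sub>R b)"]
    assms by (auto simp: dir_deriv_chain_def intro: has_vector_derivative_at_within)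

definition bdiff :: "'a::euclidean_space \<Rightarrow> ('a \<Rightarrow> complex) \<Rightarrow> 'a \<Rightarrow> complex" where
  "bdiff h f = (\<lambda>y. f y - f (y - h))"

lemma bdiff_funpow_add:
  "(bdiff h ^^ K) (\<lambda>y. f y + g y) = (\<lambda>y. (bdiff h ^^ K) f y + (bdiff h ^^ K) g y)"
  by (induction K) (auto simp: bdiff_def)

lemma continuous_on_bdiff:
  assumes "continuous_on UNIV f"
  shows "continuous_on UNIV (bdiff h f)"
proof -
  have "continuous_on UNIV (\<lambda>y. f (y - h))"
    by (rule continuous_on_compose2[OF assms]) (auto intro: continuous_intros)
  then show ?thesis
    unfolding bdiff_def by (intro continuous_on_diff assms)
qed

lemma continuous_on_bdiff_funpow: "continuous_on UNIV f \<Longrightarrow> continuous_on UNIV ((bdiff h ^^ K) f)"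
  by (induction K) (auto intro: continuous_on_bdiff)

lemma measurable_bdiff:
  assumes [measurable]: "f \<in> borel_measurable borel"
  shows "bdiff h f \<in> borel_measurable borel"
proof -
  have "(\<lambda>x. x - h) \<in> borel_measurable borel"
    by (intro borel_measurable_continuous_onI continuous_intros)
  then have [measurable]: "(\<lambda>x. f (x - h)) \<in> borel_measurable borel"
    using measurable_compose assms by blast
  show ?thesis
    unfolding bdiff_def by measurable
qed

lemma integrable_bdiff:
  fixes f :: "'a::euclidean_space \<Rightarrow> complex"
  assumes [measurable]: "f \<in> borel_measurable borel" and "integrable lborel f"
  shows "integrable lborel (bdiff h f)"
proof -
  have "integrable lborel (\<lambda>y. f (y + (- h)))"
    using assms(2) by (subst integrable_lborel_translate_iff) auto
  then show ?thesis
    unfolding bdiff_def using assms(2) by (intro Bochner_Integration.integrable_diff) auto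
qed

lemma bdiff_funpow_measurable_integrable:
  fixes f :: "'a::euclidean_space \<Rightarrow> complex"
  assumes "f \<in> borel_measurable borel" and "integrable lborel f"
  shows "(bdiff h ^^ K) f \<in> borel_measurable borel \<and> integrable lborel ((bdiff h ^^ K) f)"
  using assms by (induction K) (auto intro: measurable_bdiff integrable_bdiff)

lemma norm_bdiff_le:
  assumes F: "dir_deriv_chain b F" and r: "0 < r" and M: "\<And>y. norm (F (Suc j) y) \<le> M"
  shows "norm (bdiff (r *\<^sub>R b) (F j) y) \<le> r * M"
proof -
  have "0 \<le> M"
    using M[of 0] norm_ge_zero order_trans by blast
  then have "norm (F j y - F j (y - r *\<^sub>R b)) \<le> M * Henstock_Kurzweil_Integration.content (cbox (-r) 0)"
    by (rule has_integral_bound) (use dir_deriv_chain_has_integral[OF F r] M in auto)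
  then show ?thesis
    using r by (simp add: bdiff_def mult.commute)
qed

lemma dir_deriv_chain_diff_le_nn_integral:
  assumes F: "dir_deriv_chain b F" and r: "0 < r"
  shows "ennreal (norm (F j y - F j (y - r *\<^sub>R b)))
    \<le> (\<integral>\<^sup>+s. indicator {-r..0} s * ennreal (norm (F (Suc j) (y + s *\<^sub>R b))) \<partial>lborel)"
proof -
  let ?G = "F (Suc j)"
  have "continuous_on {-r..0} (\<lambda>s. ?G (y + s *\<^sub>R b))"
    by (intro continuous_on_compose2[OF dir_deriv_chain_continuous_on[OF F]] continuous_intros) auto
  then have int: "(\<lambda>s. norm (?G (y + s *\<^sub>R b))) integrable_on {-r..0}"
    and "(\<lambda>s. ?G (y + s *\<^sub>R b)) integrable_on {-r..0}"
    by (auto intro: integrable_continuous_interval continuous_on_norm)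
  then have "norm (F j y - F j (y - r *\<^sub>R b)) \<le> integral {-r..0} (\<lambda>s. norm (?G (y + s *\<^sub>R b)))"
    using dir_deriv_chain_has_integral[OF F r, of j y]
    by (metis integral_norm_bound_integral integral_unique order_refl)
  then have "ennreal (norm (F j y - F j (y - r *\<^sub>R b)))
      \<le> ennreal (integral {-r..0} (\<lambda>s. norm (?G (y + s *\<^sub>R b))))"
    by (rule ennreal_leI)
  also have "\<dots> = (\<integral>\<^sup>+s. ennreal (indicator {-r..0} s * norm (?G (y + s *\<^sub>R b))) \<partial>lborel)"
    by (rule nn_integral_has_integral_lebesgue[symmetric]) (auto intro: integrable_integral int)
  finally show ?thesis
    by (simp add: indicator_mult_ennreal mult.commute)
qed

lemma nn_integral_norm_bdiff_le:
  assumes F: "dir_deriv_chain b F" and r: "0 < r"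
  shows "(\<integral>\<^sup>+y. norm (bdiff (r *\<^sub>R b) (F j) y) \<partial>lborel) \<le> r * (\<integral>\<^sup>+y. norm (F (Suc j) y) \<partial>lborel)"
proof -
  let ?G = "F (Suc j)"
  have [measurable]: "?G \<in> borel_measurable borel"
    by (rule borel_measurable_continuous_onI[OF dir_deriv_chain_continuous_on[OF F]])
  have "(\<integral>\<^sup>+y. norm (bdiff (r *\<^sub>R b) (F j) y) \<partial>lborel)
      \<le> (\<integral>\<^sup>+y. \<integral>\<^sup>+s. indicator {-r..0} s * ennreal (norm (?G (y + s *\<^sub>R b))) \<partial>lborel \<partial>lborel)"
    unfolding bdiff_def by (intro nn_integral_mono dir_deriv_chain_diff_le_nn_integral[OF F r])
  also have "\<dots> = (\<integral>\<^sup>+s. \<integral>\<^sup>+y. indicator {-r..0} s * ennreal (norm (?G (y + s *\<^sub>R b))) \<partial>lborel \<partial>lborel)"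
    by (rule pair_sigma_finite.Fubini'[OF pair_sigma_finite.intro[OF sigma_finite_lborel sigma_finite_lborel]])
      measurable
  also have "\<dots> = (\<integral>\<^sup>+s. indicator {-r..0} s * (\<integral>\<^sup>+y. ennreal (norm (?G y)) \<partial>lborel) \<partial>lborel)"
  proof (intro nn_integral_cong)
    fix s :: real
    have "(\<integral>\<^sup>+y. indicator {-r..0} s * ennreal (norm (?G (y + s *\<^sub>R b))) \<partial>lborel)
        = indicator {-r..0} s * (\<integral>\<^sup>+y. ennreal (norm (?G (y + s *\<^sub>R b))) \<partial>lborel)"
      by (rule nn_integral_cmult) measurable
    also have "(\<integral>\<^sup>+y. ennreal (norm (?G (y + s *\<^sub>R b))) \<partial>lborel) = (\<integral>\<^sup>+y. ennreal (norm (?G y)) \<partial>lborel)"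
      by (rule lborel_nn_integral_translate[where f = "\<lambda>y. ennreal (norm (?G y))"]) measurable
    finally show "(\<integral>\<^sup>+y. indicator {-r..0} s * ennreal (norm (?G (y + s *\<^sub>R b))) \<partial>lborel)
        = indicator {-r..0} s * (\<integral>\<^sup>+y. ennreal (norm (?G y)) \<partial>lborel)" .
  qed
  also have "\<dots> = r * (\<integral>\<^sup>+y. ennreal (norm (?G y)) \<partial>lborel)"
    using r by (simp add: nn_integral_multc mult.commute)
  finally show ?thesis .
qed

lemma dir_deriv_chain_translate:
  assumes "dir_deriv_chain b F"
  shows "dir_deriv_chain b (\<lambda>j y. F j (y - h))"
  unfolding dir_deriv_chain_def
proof (intro conjI allI)
  fix j y t
  have "((\<lambda>s. F j ((y - h) + s *\<^sub>R b)) has_vector_derivative F (Suc j) ((y - h) + t *\<^sub>R b)) (at t)"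
    using assms unfolding dir_deriv_chain_def by blast
  then show "((\<lambda>s. F j (y + s *\<^sub>R b - h)) has_vector_derivative F (Suc j) (y + t *\<^sub>R b - h)) (at t)"
    by (simp add: algebra_simps)
next
  fix j
  show "continuous_on UNIV (\<lambda>y. F j (y - h))"
    by (rule continuous_on_compose2[OF dir_deriv_chain_continuous_on[OF assms]])
      (auto intro: continuous_intros)
qed

lemma dir_deriv_chain_bdiff:
  assumes "dir_deriv_chain b F"
  shows "dir_deriv_chain b (\<lambda>j. bdiff h (F j))"
  unfolding dir_deriv_chain_def
proof (intro conjI allI)
  fix j y t
  have "((\<lambda>s. F j (y + s *\<^sub>R b) - F j (y + s *\<^sub>R b - h)) has_vector_derivative
      F (Suc j) (y + t *\<^sub>R b) - F (Suc j) (y + t *\<^sub>R b - h)) (at t)"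
    using assms dir_deriv_chain_translate[OF assms, of h]
    by (intro has_vector_derivative_diff) (auto simp: dir_deriv_chain_def)
  then show "((\<lambda>s. bdiff h (F j) (y + s *\<^sub>R b)) has_vector_derivative bdiff h (F (Suc j)) (y + t *\<^sub>R b)) (at t)"
    by (simp add: bdiff_def)
next
  fix j
  show "continuous_on UNIV (bdiff h (F j))"
    using assms by (intro continuous_on_bdiff dir_deriv_chain_continuous_on)
qed

lemma bdiff_mult: "bdiff h (\<lambda>y. f y * g y) = (\<lambda>y. f y * bdiff h g y + bdiff h f y * g (y - h))"
  unfolding bdiff_def by (rule ext) (simp add: ring_distribs)

text \<open>Iterating \<open>bdiff_mult\<close>, each of the \<open>2\<^sup>K\<close> terms of \<open>bdiff (r b) ^^ K (F G)\<close> carries \<open>K\<close> differences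
  of length \<open>r\<close> along \<open>b\<close>, each costing a factor \<open>r\<close> (in sup norm on \<open>F\<close>, in \<open>L\<^sup>1\<close> on \<open>G\<close>).\<close>

lemma nn_integral_bdiff_funpow_mult_le:
  assumes "0 < r" "dir_deriv_chain b F" "dir_deriv_chain b G"
    and "\<And>j y. j \<le> K \<Longrightarrow> norm (F j y) \<le> M"
    and "\<And>j. j \<le> K \<Longrightarrow> (\<integral>\<^sup>+y. norm (G j y) \<partial>lborel) \<le> ennreal L"
    and "0 \<le> M" "0 \<le> L"
  shows "(\<integral>\<^sup>+y. norm ((bdiff (r *\<^sub>R b) ^^ K) (\<lambda>y. F 0 y * G 0 y) y) \<partial>lborel) \<le> ennreal ((2 * r) ^ K * M * L)"
  using assms(2-)
proof (induction K arbitrary: F G M L)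
  case 0
  have "G 0 \<in> borel_measurable borel"
    using 0 by (intro borel_measurable_continuous_onI dir_deriv_chain_continuous_on)
  then have "(\<integral>\<^sup>+y. norm (F 0 y * G 0 y) \<partial>lborel) \<le> ennreal M * (\<integral>\<^sup>+y. norm (G 0 y) \<partial>lborel)"
    using 0 by (intro nn_integral_norm_mult_le) auto
  also have "\<dots> \<le> ennreal M * ennreal L"
    using 0 by (intro mult_left_mono) auto
  finally show ?case
    using 0 by (simp add: ennreal_mult[symmetric])
next
  case (Suc K F G M L)
  let ?h = "r *\<^sub>R b"
  let ?D = "bdiff ?h ^^ K"
  let ?F' = "\<lambda>j. bdiff ?h (F j)" and ?G' = "\<lambda>j. bdiff ?h (G j)" and ?G'' = "\<lambda>j y. G j (y - ?h)"
  have F': "dir_deriv_chain b ?F'" and G': "dir_deriv_chain b ?G'" and G'': "dir_deriv_chain b ?G''"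
    using Suc.prems by (auto intro: dir_deriv_chain_bdiff dir_deriv_chain_translate)
  have first: "(\<integral>\<^sup>+y. norm (?D (\<lambda>y. F 0 y * ?G' 0 y) y) \<partial>lborel) \<le> ennreal ((2 * r) ^ K * M * (r * L))"
  proof (rule Suc.IH[OF Suc.prems(1) G'])
    show "(\<integral>\<^sup>+y. norm (?G' j y) \<partial>lborel) \<le> ennreal (r * L)" if "j \<le> K" for j
    proof -
      have "(\<integral>\<^sup>+y. norm (?G' j y) \<partial>lborel) \<le> ennreal r * ennreal L"
        using nn_integral_norm_bdiff_le[OF Suc.prems(2) \<open>0 < r\<close>, of j] Suc.prems(4)[of "Suc j"] that
        by (meson Suc_le_mono mult_left_mono order_trans zero_le)
      then show ?thesis
        using \<open>0 < r\<close> Suc.prems(6) by (simp add: ennreal_mult)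
    qed
  qed (use Suc.prems \<open>0 < r\<close> in auto)
  have second: "(\<integral>\<^sup>+y. norm (?D (\<lambda>y. ?F' 0 y * ?G'' 0 y) y) \<partial>lborel) \<le> ennreal ((2 * r) ^ K * (r * M) * L)"
  proof (rule Suc.IH[OF F' G''])
    show "norm (?F' j y) \<le> r * M" if "j \<le> K" for j y
      by (rule norm_bdiff_le[OF Suc.prems(1) \<open>0 < r\<close>]) (use Suc.prems(3) that in auto)
    show "(\<integral>\<^sup>+y. norm (?G'' j y) \<partial>lborel) \<le> ennreal L" if "j \<le> K" for j
      using Suc.prems(4)[of j] that
      by (simp add: lborel_nn_integral_norm_translate borel_measurable_continuous_onI
          dir_deriv_chain_continuous_on[OF Suc.prems(2)])
  qed (use Suc.prems \<open>0 < r\<close> in auto)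
  have "(bdiff ?h ^^ Suc K) (\<lambda>y. F 0 y * G 0 y)
      = (\<lambda>y. ?D (\<lambda>y. F 0 y * ?G' 0 y) y + ?D (\<lambda>y. ?F' 0 y * ?G'' 0 y) y)"
    by (simp only: funpow_Suc_right comp_def bdiff_mult bdiff_funpow_add)
  moreover have [measurable]: "?D (\<lambda>y. F 0 y * ?G' 0 y) \<in> borel_measurable borel"
    "?D (\<lambda>y. ?F' 0 y * ?G'' 0 y) \<in> borel_measurable borel"
    using F' G'' Suc.prems(1) G'
    by (intro borel_measurable_continuous_onI continuous_on_bdiff_funpow continuous_intros
        dir_deriv_chain_continuous_on; blast)+
  ultimately have "(\<integral>\<^sup>+y. norm ((bdiff ?h ^^ Suc K) (\<lambda>y. F 0 y * G 0 y) y) \<partial>lborel)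
      \<le> (\<integral>\<^sup>+y. norm (?D (\<lambda>y. F 0 y * ?G' 0 y) y) \<partial>lborel)
        + (\<integral>\<^sup>+y. norm (?D (\<lambda>y. ?F' 0 y * ?G'' 0 y) y) \<partial>lborel)"
    by (simp only:) (rule nn_integral_norm_add_le; measurable)
  also have "\<dots> \<le> ennreal ((2 * r) ^ K * M * (r * L)) + ennreal ((2 * r) ^ K * (r * M) * L)"
    by (intro add_mono first second)
  also have "\<dots> = ennreal ((2 * r) ^ Suc K * M * L)"
    using \<open>0 < r\<close> Suc.prems by (subst ennreal_plus[symmetric]) (auto simp: algebra_simps)
  finally show ?case .
qed

section \<open>The Fourier transform\<close>

definition fourier :: "('a::euclidean_space \<Rightarrow> complex) \<Rightarrow> 'a \<Rightarrow> complex" where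
  "fourier f \<xi> = (\<integral>y. f y * exp (- \<i> * complex_of_real (y \<bullet> \<xi>)) \<partial>lborel)"

lemma norm_exp_neg_i_times [simp]: "norm (exp (- \<i> * complex_of_real t)) = 1"
  using norm_exp_i_times[of "- t"] by simp

lemma integrable_mult_exp_neg_i_inner:
  fixes f :: "'a::euclidean_space \<Rightarrow> complex"
  assumes [measurable]: "f \<in> borel_measurable borel" and "integrable lborel f"
  shows "integrable lborel (\<lambda>y. f y * exp (- \<i> * complex_of_real (y \<bullet> \<xi>)))"
  by (rule Bochner_Integration.integrable_bound[OF assms(2)]) (auto simp: norm_mult)

text \<open>Since \<open>\<langle>h, \<xi>\<rangle> = \<plusminus>\<pi>\<close>, the shift by \<open>h\<close> changes the sign of \<open>exp (- i \<langle>y, \<xi>\<rangle>)\<close>.\<close>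

lemma fourier_bdiff:
  fixes f :: "'a::euclidean_space \<Rightarrow> complex"
  assumes [measurable]: "f \<in> borel_measurable borel" and f: "integrable lborel f"
    and "\<xi> \<bullet> b \<noteq> 0"
  shows "fourier (bdiff ((pi / \<bar>\<xi> \<bullet> b\<bar>) *\<^sub>R b) f) \<xi> = 2 * fourier f \<xi>"
proof -
  let ?h = "(pi / \<bar>\<xi> \<bullet> b\<bar>) *\<^sub>R b"
  let ?e = "\<lambda>y. exp (- \<i> * complex_of_real (y \<bullet> \<xi>))"
  have "?h \<bullet> \<xi> = pi * sgn (\<xi> \<bullet> b)"
    using assms(3) by (auto simp: inner_commute sgn_if abs_if field_simps)
  then have "exp (- \<i> * complex_of_real (?h \<bullet> \<xi>)) = -1"
    using assms(3) by (auto simp: sgn_if exp_minus exp_pi_i' mult.commute[of \<i>])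
  moreover have "?e (y + ?h) = ?e y * exp (- \<i> * complex_of_real (?h \<bullet> \<xi>))" for y
    by (simp add: inner_add_left distrib_left exp_add[symmetric])
  ultimately have half_period: "?e (y + ?h) = - ?e y" for y
    by simp
  have "integrable lborel (\<lambda>y. f (y + (- ?h)))"
    using f by (subst integrable_lborel_translate_iff) auto
  then have int_shifted: "integrable lborel (\<lambda>y. f (y - ?h) * ?e y)"
    by (intro integrable_mult_exp_neg_i_inner) auto
  have "(\<integral>y. f (y - ?h) * ?e y \<partial>lborel) = (\<integral>y. f ((y + ?h) - ?h) * ?e (y + ?h) \<partial>lborel)"
    by (rule lborel_integral_translate[symmetric]) measurable
  also have "\<dots> = - fourier f \<xi>"
    by (simp only: add_diff_cancel half_period mult_minus_right Bochner_Integration.integral_minus fourier_def)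
  finally have shifted: "(\<integral>y. f (y - ?h) * ?e y \<partial>lborel) = - fourier f \<xi>" .
  have "fourier (bdiff ?h f) \<xi> = (\<integral>y. f y * ?e y - f (y - ?h) * ?e y \<partial>lborel)"
    unfolding fourier_def bdiff_def by (simp add: left_diff_distrib)
  also have "\<dots> = fourier f \<xi> - (\<integral>y. f (y - ?h) * ?e y \<partial>lborel)"
    unfolding fourier_def
    by (rule Bochner_Integration.integral_diff[OF integrable_mult_exp_neg_i_inner[OF _ f] int_shifted]) simp
  finally show ?thesis
    using shifted by simp
qed

lemma fourier_bdiff_funpow:
  fixes f :: "'a::euclidean_space \<Rightarrow> complex"
  assumes "f \<in> borel_measurable borel" and "integrable lborel f" and "\<xi> \<bullet> b \<noteq> 0"
  shows "fourier ((bdiff ((pi / \<bar>\<xi> \<bullet> b\<bar>) *\<^sub>R b) ^^ K) f) \<xi> = 2 ^ K * fourier f \<xi>"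
proof (induction K)
  case (Suc K)
  then show ?case
    using bdiff_funpow_measurable_integrable[OF assms(1,2)] assms(3) by (simp add: fourier_bdiff)
qed simp

lemma norm_fourier_mult_le:
  fixes F G :: "nat \<Rightarrow> 'a::euclidean_space \<Rightarrow> complex"
  assumes F: "dir_deriv_chain b F" and G: "dir_deriv_chain b G"
    and M: "\<And>j y. j \<le> K \<Longrightarrow> norm (F j y) \<le> M"
    and L: "\<And>j. j \<le> K \<Longrightarrow> (\<integral>\<^sup>+y. norm (G j y) \<partial>lborel) \<le> ennreal L"
    and "0 \<le> M" "0 \<le> L"
    and int: "integrable lborel (\<lambda>y. F 0 y * G 0 y)"
    and "\<xi> \<bullet> b \<noteq> 0"
  shows "norm (fourier (\<lambda>y. F 0 y * G 0 y) \<xi>) \<le> (pi / \<bar>\<xi> \<bullet> b\<bar>) ^ K * M * L"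
proof -
  define r where "r = pi / \<bar>\<xi> \<bullet> b\<bar>"
  have "0 < r"
    using \<open>\<xi> \<bullet> b \<noteq> 0\<close> by (simp add: r_def)
  let ?p = "\<lambda>y. F 0 y * G 0 y"
  let ?D = "(bdiff (r *\<^sub>R b) ^^ K) ?p"
  have [measurable]: "?p \<in> borel_measurable borel"
    using F G by (intro borel_measurable_continuous_onI continuous_intros dir_deriv_chain_continuous_on)
  have D: "?D \<in> borel_measurable borel" "integrable lborel ?D"
    using bdiff_funpow_measurable_integrable[OF _ int] by auto
  have "2 ^ K * norm (fourier ?p \<xi>) = norm (fourier ?D \<xi>)"
    using fourier_bdiff_funpow[OF _ int \<open>\<xi> \<bullet> b \<noteq> 0\<close>] by (simp add: r_def norm_mult norm_power)
  also have "\<dots> \<le> (2 * r) ^ K * M * L"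
    unfolding fourier_def
  proof (rule norm_integral_le_of_nn_integral_le)
    show "integrable lborel (\<lambda>y. ?D y * exp (- \<i> * complex_of_real (y \<bullet> \<xi>)))"
      using D by (intro integrable_mult_exp_neg_i_inner)
    have "(\<integral>\<^sup>+y. norm (?D y * exp (- \<i> * complex_of_real (y \<bullet> \<xi>))) \<partial>lborel) = (\<integral>\<^sup>+y. norm (?D y) \<partial>lborel)"
      by (simp add: norm_mult)
    also have "\<dots> \<le> ennreal ((2 * r) ^ K * M * L)"
      by (rule nn_integral_bdiff_funpow_mult_le) (use \<open>0 < r\<close> assms in auto)
    finally show "(\<integral>\<^sup>+y. norm (?D y * exp (- \<i> * complex_of_real (y \<bullet> \<xi>))) \<partial>lborel)
        \<le> ennreal ((2 * r) ^ K * M * L)" .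
  qed (use \<open>0 < r\<close> assms in auto)
  finally have "2 ^ K * norm (fourier ?p \<xi>) \<le> 2 ^ K * (r ^ K * M * L)"
    by (simp add: power_mult_distrib mult_ac)
  then show ?thesis
    by (simp add: r_def)
qed

subsection \<open>Injectivity of the Fourier transform\<close>

definition std_gauss :: "'a::euclidean_space \<Rightarrow> real" where
  "std_gauss v = (\<Prod>b\<in>Basis. std_normal_density (v \<bullet> b))"

lemma std_gauss_nonneg: "0 \<le> std_gauss v"
  unfolding std_gauss_def by (intro prod_nonneg) auto

lemma continuous_on_std_gauss: "continuous_on S std_gauss"
  unfolding std_gauss_def normal_density_def by (intro continuous_intros) auto

lemma integrable_std_gauss: "integrable lborel (std_gauss :: 'a::euclidean_space \<Rightarrow> real)"
  unfolding std_gauss_def[abs_def] by (rule integrable_lborel_prod_coords) auto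

lemma integral_std_gauss: "(\<integral>v. std_gauss (v::'a::euclidean_space) \<partial>lborel) = 1"
  unfolding std_gauss_def by (subst integral_lborel_prod_coords) auto

lemma integral_std_normal_density_exp:
  "(\<integral>t. complex_of_real (std_normal_density t) * exp (\<i> * complex_of_real (s * t)) \<partial>lborel)
    = complex_of_real (exp (- s\<^sup>2 / 2))"
proof -
  have "char std_normal_distribution s = complex_of_real (exp (- s\<^sup>2 / 2))"
    by (simp add: char_std_normal_distribution)
  moreover have "char std_normal_distribution s
      = (\<integral>t. std_normal_density t *\<^sub>R exp (\<i> * complex_of_real (s * t)) \<partial>lborel)"
    unfolding char_def by (rule integral_density) auto
  ultimately show ?thesis
    by (simp add: scaleR_conv_of_real)
qed

lemma integral_std_gauss_exp:
  "(\<integral>\<xi>. complex_of_real (std_gauss \<xi>) * exp (\<i> * complex_of_real (w \<bullet> \<xi>)) \<partial>lborel)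
     = complex_of_real (sqrt (2 * pi) ^ DIM('a) * std_gauss (w::'a::euclidean_space))"
proof -
  let ?f = "\<lambda>b t. complex_of_real (std_normal_density t) * exp (\<i> * complex_of_real ((w \<bullet> b) * t))"
  have eq: "complex_of_real (std_gauss \<xi>) * exp (\<i> * complex_of_real (w \<bullet> \<xi>)) = (\<Prod>b\<in>Basis. ?f b (\<xi> \<bullet> b))" for \<xi>
  proof -
    have "w \<bullet> \<xi> = (\<Sum>b\<in>Basis. (w \<bullet> b) * (\<xi> \<bullet> b))"
      by (rule euclidean_inner)
    then have "exp (\<i> * complex_of_real (w \<bullet> \<xi>)) = (\<Prod>b\<in>Basis. exp (\<i> * complex_of_real ((w \<bullet> b) * (\<xi> \<bullet> b))))"
      by (simp add: sum_distrib_left exp_sum)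
    then show ?thesis
      by (simp add: std_gauss_def prod.distrib)
  qed
  have "integrable lborel (?f b)" for b
    by (rule Bochner_Integration.integrable_bound[OF integrable_normal_density[where \<mu>=0 and \<sigma>=1]])
      (auto simp: norm_mult)
  then have "(\<integral>\<xi>. (\<Prod>b\<in>Basis. ?f b (\<xi> \<bullet> b)) \<partial>lborel) = (\<Prod>b\<in>(Basis::'a set). \<integral>t. ?f b t \<partial>lborel)"
    by (rule integral_lborel_prod_coords)
  also have "\<dots> = (\<Prod>b\<in>(Basis::'a set). complex_of_real (exp (- (w \<bullet> b)\<^sup>2 / 2)))"
    by (intro prod.cong refl) (rule integral_std_normal_density_exp)
  also have "\<dots> = (\<Prod>b\<in>(Basis::'a set). complex_of_real (sqrt (2 * pi) * std_normal_density (w \<bullet> b)))"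
    by (intro prod.cong refl) (simp add: std_normal_density_def)
  also have "\<dots> = complex_of_real (sqrt (2 * pi) ^ DIM('a) * std_gauss w)"
    by (simp add: std_gauss_def prod.distrib)
  finally show ?thesis
    by (simp only: eq)
qed

lemma integrable_std_gauss_fourier_kernel:
  fixes h :: "'a::euclidean_space \<Rightarrow> complex"
  assumes cont: "continuous_on UNIV h" and int: "integrable lborel h"
  shows "integrable (lborel \<Otimes>\<^sub>M lborel) (\<lambda>(\<xi>, y). complex_of_real (std_gauss \<xi>)
      * exp (\<i> * complex_of_real (t * (y0 \<bullet> \<xi>))) * (h y * exp (- \<i> * complex_of_real (y \<bullet> (t *\<^sub>R \<xi>)))))"
    (is "integrable _ (\<lambda>(\<xi>, y). ?F \<xi> y)")
proof (rule Bochner_Integration.integrable_bound[OF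
      integrable_pair_lborel_mult[OF integrable_std_gauss integrable_norm[OF int]]])
  have "continuous_on UNIV (\<lambda>p::'a \<times> 'a. std_gauss (fst p))"
    by (rule continuous_on_compose2[OF continuous_on_std_gauss]) (auto intro: continuous_intros)
  moreover have "continuous_on UNIV (\<lambda>p::'a \<times> 'a. h (snd p))"
    by (rule continuous_on_compose2[OF cont]) (auto intro: continuous_intros)
  ultimately have "continuous_on UNIV (\<lambda>p::'a \<times> 'a. ?F (fst p) (snd p))"
    by (intro continuous_on_mult continuous_on_of_real continuous_on_exp continuous_on_const
        continuous_on_inner continuous_on_fst continuous_on_snd continuous_on_id continuous_on_scaleR)
  then show "(\<lambda>(\<xi>, y). ?F \<xi> y) \<in> borel_measurable (lborel \<Otimes>\<^sub>M lborel)"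
    by (simp add: case_prod_beta' measurable_pair_lborel_of_borel borel_measurable_continuous_onI)
qed (auto simp: norm_mult std_gauss_nonneg)

text \<open>Fubini for \<open>std_gauss \<xi> * exp (i t \<langle>y0 - y, \<xi>\<rangle>) * h y\<close>: integrating in \<open>y\<close> first gives
  \<open>fourier h (t \<xi>) = 0\<close>, integrating in \<open>\<xi>\<close> first reproduces the Gaussian.\<close>

lemma fourier_zero_imp_gauss_conv_zero:
  fixes h :: "'a::euclidean_space \<Rightarrow> complex"
  assumes cont: "continuous_on UNIV h" and int: "integrable lborel h"
    and zero: "\<And>\<xi>. fourier h \<xi> = 0"
  shows "(\<integral>y. h y * complex_of_real (std_gauss (t *\<^sub>R (y0 - y))) \<partial>lborel) = 0"
proof -
  define F where "F = (\<lambda>\<xi> y. complex_of_real (std_gauss \<xi>) * exp (\<i> * complex_of_real (t * (y0 \<bullet> \<xi>)))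
      * (h y * exp (- \<i> * complex_of_real (y \<bullet> (t *\<^sub>R \<xi>)))))"
  have intF: "integrable (lborel \<Otimes>\<^sub>M lborel) (\<lambda>(\<xi>, y). F \<xi> y)"
    unfolding F_def by (rule integrable_std_gauss_fourier_kernel[OF cont int])
  have "(\<integral>y. F \<xi> y \<partial>lborel)
      = complex_of_real (std_gauss \<xi>) * exp (\<i> * complex_of_real (t * (y0 \<bullet> \<xi>))) * fourier h (t *\<^sub>R \<xi>)" for \<xi>
    unfolding F_def fourier_def by (rule integral_mult_right_zero)
  then have "(\<integral>\<xi>. (\<integral>y. F \<xi> y \<partial>lborel) \<partial>lborel) = 0"
    by (simp add: zero)
  moreover have "(\<integral>y. (\<integral>\<xi>. F \<xi> y \<partial>lborel) \<partial>lborel) = (\<integral>\<xi>. (\<integral>y. F \<xi> y \<partial>lborel) \<partial>lborel)"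
    by (rule pair_sigma_finite.Fubini_integral[OF
          pair_sigma_finite.intro[OF sigma_finite_lborel sigma_finite_lborel] intF])
  moreover have "(\<integral>\<xi>. F \<xi> y \<partial>lborel)
      = complex_of_real (sqrt (2 * pi) ^ DIM('a)) * (h y * complex_of_real (std_gauss (t *\<^sub>R (y0 - y))))" for y
  proof -
    have "F \<xi> y = h y * (complex_of_real (std_gauss \<xi>) * exp (\<i> * complex_of_real ((t *\<^sub>R (y0 - y)) \<bullet> \<xi>)))" for \<xi>
    proof -
      have "exp (\<i> * complex_of_real (t * (y0 \<bullet> \<xi>))) * exp (- \<i> * complex_of_real (y \<bullet> (t *\<^sub>R \<xi>)))
          = exp (\<i> * complex_of_real ((t *\<^sub>R (y0 - y)) \<bullet> \<xi>))"
        by (simp add: exp_add[symmetric] inner_diff_left algebra_simps)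
      then show ?thesis
        unfolding F_def by (simp add: mult_ac)
    qed
    then have "(\<integral>\<xi>. F \<xi> y \<partial>lborel)
        = h y * (\<integral>\<xi>. complex_of_real (std_gauss \<xi>) * exp (\<i> * complex_of_real ((t *\<^sub>R (y0 - y)) \<bullet> \<xi>)) \<partial>lborel)"
      by (simp only: integral_mult_right_zero)
    then show ?thesis
      by (simp only: integral_std_gauss_exp) (simp add: mult_ac)
  qed
  ultimately have "(\<integral>y. complex_of_real (sqrt (2 * pi) ^ DIM('a))
      * (h y * complex_of_real (std_gauss (t *\<^sub>R (y0 - y)))) \<partial>lborel) = 0"
    by (simp only:)
  then have "complex_of_real (sqrt (2 * pi) ^ DIM('a))
      * (\<integral>y. h y * complex_of_real (std_gauss (t *\<^sub>R (y0 - y))) \<partial>lborel) = 0"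
    by (simp only: integral_mult_right_zero)
  moreover have "complex_of_real (sqrt (2 * pi) ^ DIM('a)) \<noteq> 0"
    by simp
  ultimately show ?thesis
    by (simp only: mult_eq_0_iff) blast
qed

lemma fourier_zero_imp_integral_dilated_gauss_zero:
  fixes h :: "'a::euclidean_space \<Rightarrow> complex"
  assumes cont: "continuous_on UNIV h" and int: "integrable lborel h"
    and zero: "\<And>\<xi>. fourier h \<xi> = 0" and "0 < t"
  shows "(\<integral>v. h (y0 - (1 / t) *\<^sub>R v) * complex_of_real (std_gauss v) \<partial>lborel) = 0"
proof -
  have meas: "(\<lambda>y. h y * complex_of_real (std_gauss (t *\<^sub>R (y0 - y)))) \<in> borel_measurable borel"
    by (intro borel_measurable_continuous_onI continuous_intros cont
        continuous_on_compose2[OF continuous_on_std_gauss]) auto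
  have "(\<integral>y. h y * complex_of_real (std_gauss (t *\<^sub>R (y0 - y))) \<partial>lborel)
      = \<bar>- 1 / t\<bar> ^ DIM('a) *\<^sub>R (\<integral>v. h (y0 + (- 1 / t) *\<^sub>R v)
          * complex_of_real (std_gauss (t *\<^sub>R (y0 - (y0 + (- 1 / t) *\<^sub>R v)))) \<partial>lborel)"
    by (rule lborel_integral_affine[OF meas, of "- 1 / t" y0]) (use \<open>0 < t\<close> in simp)
  also have "(\<lambda>v. h (y0 + (- 1 / t) *\<^sub>R v) * complex_of_real (std_gauss (t *\<^sub>R (y0 - (y0 + (- 1 / t) *\<^sub>R v)))))
      = (\<lambda>v. h (y0 - (1 / t) *\<^sub>R v) * complex_of_real (std_gauss v))"
  proof
    fix v :: 'a
    have "y0 + (- 1 / t) *\<^sub>R v = y0 - (1 / t) *\<^sub>R v" and "t *\<^sub>R (y0 - (y0 - (1 / t) *\<^sub>R v)) = v"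
      using \<open>0 < t\<close> by simp_all
    then show "h (y0 + (- 1 / t) *\<^sub>R v) * complex_of_real (std_gauss (t *\<^sub>R (y0 - (y0 + (- 1 / t) *\<^sub>R v))))
        = h (y0 - (1 / t) *\<^sub>R v) * complex_of_real (std_gauss v)"
      by (simp only:)
  qed
  finally show ?thesis
    using fourier_zero_imp_gauss_conv_zero[OF cont int zero] \<open>0 < t\<close> by simp
qed

lemma fourier_eq_zero_imp_eq_zero:
  fixes h :: "'a::euclidean_space \<Rightarrow> complex"
  assumes cont: "continuous_on UNIV h" and bounded: "\<And>y. norm (h y) \<le> B"
    and int: "integrable lborel h" and zero: "\<And>\<xi>. fourier h \<xi> = 0"
  shows "h y0 = 0"
proof -
  define s where "s = (\<lambda>n v. h (y0 - (1 / real (Suc n)) *\<^sub>R v) * complex_of_real (std_gauss v))"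
  have "(\<integral>v. s n v \<partial>lborel) = 0" for n
    unfolding s_def by (rule fourier_zero_imp_integral_dilated_gauss_zero[OF cont int zero]) simp
  moreover have "(\<lambda>n. \<integral>v. s n v \<partial>lborel) \<longlonglongrightarrow> (\<integral>v. h y0 * complex_of_real (std_gauss (v::'a)) \<partial>lborel)"
  proof (rule integral_dominated_convergence[where w="\<lambda>v. B * std_gauss v"])
    show "s n \<in> borel_measurable lborel" for n
    proof -
      have "continuous_on UNIV (s n)"
        unfolding s_def
        by (intro continuous_intros continuous_on_compose2[OF cont] continuous_on_std_gauss) auto
      then show ?thesis
        by (simp add: borel_measurable_continuous_onI)
    qed
    show "integrable lborel (\<lambda>v. B * std_gauss v)"
      by (intro integrable_mult_right integrable_std_gauss)
    show "AE v in lborel. (\<lambda>n. s n v) \<longlonglongrightarrow> h y0 * complex_of_real (std_gauss v)"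
    proof (intro AE_I2)
      fix v :: 'a
      have "(\<lambda>n. y0 - (1 / real (Suc n)) *\<^sub>R v) \<longlonglongrightarrow> y0 - 0 *\<^sub>R v"
        by (intro tendsto_intros LIMSEQ_Suc[OF lim_const_over_n])
      then have "(\<lambda>n. y0 - (1 / real (Suc n)) *\<^sub>R v) \<longlonglongrightarrow> y0"
        by simp
      moreover have "isCont h y0"
        using cont by (simp add: continuous_on_eq_continuous_at)
      ultimately have "(\<lambda>n. h (y0 - (1 / real (Suc n)) *\<^sub>R v)) \<longlonglongrightarrow> h y0"
        by (rule isCont_tendsto_compose[rotated])
      then show "(\<lambda>n. s n v) \<longlonglongrightarrow> h y0 * complex_of_real (std_gauss v)"
        unfolding s_def by (intro tendsto_intros)
    qed
    show "AE v in lborel. norm (s n v) \<le> B * std_gauss v" for n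
      by (intro AE_I2) (auto simp: s_def norm_mult std_gauss_nonneg intro: mult_right_mono bounded)
    show "(\<lambda>v. h y0 * complex_of_real (std_gauss v)) \<in> borel_measurable lborel"
      using borel_measurable_continuous_onI[OF continuous_on_std_gauss] by measurable
  qed
  ultimately have "(\<lambda>n. 0) \<longlonglongrightarrow> h y0"
    using integral_std_gauss[where 'a='a] by simp
  then show ?thesis
    using LIMSEQ_unique tendsto_const by blast
qed

section \<open>Decay criteria for the Gabor wave front set\<close>

lemma one_le_jbr: "1 \<le> jbr z"
  unfolding jbr_def by simp

lemma jbr_powr_le_power:
  assumes "0 \<le> N" and "N \<le> real K"
  shows "jbr z powr N \<le> (1 + (norm z)\<^sup>2) ^ K"
proof -
  have "jbr z powr N \<le> jbr z powr real K"
    by (rule powr_mono[OF assms(2) one_le_jbr])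
  also have "\<dots> = jbr z ^ K"
    using one_le_jbr[of z] by (intro powr_realpow) simp
  also have "\<dots> \<le> ((jbr z)\<^sup>2) ^ K"
    using one_le_jbr[of z]
    by (intro power_mono) (auto simp: power2_eq_square intro: order_trans[OF _ mult_right_mono[of 1]])
  also have "(jbr z)\<^sup>2 = 1 + (norm z)\<^sup>2"
    unfolding jbr_def by simp
  finally show ?thesis .
qed

lemma not_in_gabor_WF_if_decay:
  assumes "z0 \<noteq> 0" "open \<Gamma>" "conic \<Gamma>" "0 \<notin> \<Gamma>" "z0 \<in> \<Gamma>"
    and decay: "\<And>K::nat. \<exists>C. \<forall>z\<in>\<Gamma>. (1 + (norm z)\<^sup>2) ^ K * norm (stft \<phi> u z) \<le> C"
  shows "z0 \<notin> gabor_WF \<phi> u"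
proof -
  have "\<exists>C. \<forall>z\<in>\<Gamma>. jbr z powr N * norm (stft \<phi> u z) \<le> C" if "0 \<le> N" for N :: real
  proof -
    obtain C where C: "\<forall>z\<in>\<Gamma>. (1 + (norm z)\<^sup>2) ^ nat \<lceil>N\<rceil> * norm (stft \<phi> u z) \<le> C"
      using decay by blast
    have "jbr z powr N * norm (stft \<phi> u z) \<le> (1 + (norm z)\<^sup>2) ^ nat \<lceil>N\<rceil> * norm (stft \<phi> u z)" for z
      using that by (intro mult_right_mono jbr_powr_le_power) auto
    then show ?thesis
      using C order_trans by blast
  qed
  then show ?thesis
    using assms unfolding gabor_WF_def by blast
qed

lemma power_decay_in_cone:
  fixes g l :: "'a::real_normed_vector \<Rightarrow> real"
  assumes "0 < c" and nonneg: "\<And>z. 0 \<le> g z" and bounded: "\<And>z. g z \<le> C0"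
    and decay: "\<And>z. l z \<noteq> 0 \<Longrightarrow> g z \<le> C * (1 / \<bar>l z\<bar>) ^ (2 * K)" and "0 \<le> C"
  shows "\<exists>D. \<forall>z. c * norm z < \<bar>l z\<bar> \<longrightarrow> (1 + (norm z)\<^sup>2) ^ K * g z \<le> D"
proof (intro exI allI impI)
  fix z assume cone: "c * norm z < \<bar>l z\<bar>"
  have "0 \<le> C0"
    using nonneg bounded order_trans by blast
  show "(1 + (norm z)\<^sup>2) ^ K * g z \<le> 2 ^ K * C0 + 2 ^ K * (C * (1 / c) ^ (2 * K))"
  proof (cases "norm z \<le> 1")
    case True
    then have "(1 + (norm z)\<^sup>2) ^ K \<le> 2 ^ K"
      by (intro power_mono) (auto simp: abs_square_le_1)
    then have "(1 + (norm z)\<^sup>2) ^ K * g z \<le> 2 ^ K * C0"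
      using nonneg bounded \<open>0 \<le> C0\<close> by (intro mult_mono) auto
    moreover have "0 \<le> 2 ^ K * (C * (1 / c) ^ (2 * K))"
      using \<open>0 < c\<close> \<open>0 \<le> C\<close> by simp
    ultimately show ?thesis
      by linarith
  next
    case False
    have cz: "0 < c * norm z"
      using \<open>0 < c\<close> False by (intro mult_pos_pos) auto
    then have "1 / \<bar>l z\<bar> \<le> 1 / (c * norm z)"
      using cone by (intro divide_left_mono) auto
    then have "(1 / \<bar>l z\<bar>) ^ (2 * K) \<le> (1 / (c * norm z)) ^ (2 * K)"
      by (intro power_mono) auto
    then have "g z \<le> C * (1 / (c * norm z)) ^ (2 * K)"
      using decay[of z] cone cz \<open>0 \<le> C\<close> by (smt (verit) mult_left_mono)
    then have "(1 + (norm z)\<^sup>2) ^ K * g z \<le> 2 ^ K * norm z ^ (2 * K) * (C * (1 / (c * norm z)) ^ (2 * K))"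
      using False nonneg by (intro mult_mono one_plus_square_power_le) auto
    also have "\<dots> = 2 ^ K * (C * (norm z * (1 / (c * norm z))) ^ (2 * K))"
      by (simp only: power_mult_distrib mult_ac)
    also have "norm z * (1 / (c * norm z)) = 1 / c"
      using False by (cases "z = 0") (simp_all add: field_simps)
    finally show ?thesis
      using \<open>0 \<le> C0\<close> by (simp add: add_increasing)
  qed
qed

lemma open_conic_contains_shifted_line:
  fixes x0 \<xi> :: "'a::real_normed_vector"
  assumes "open \<Gamma>" and "conic \<Gamma>" and "(x0, 0) \<in> \<Gamma>"
  shows "\<exists>T>0. \<forall>t\<ge>T. (t *\<^sub>R x0, \<xi>) \<in> \<Gamma>"
proof -
  obtain e where "0 < e" and e: "ball (x0, 0) e \<subseteq> \<Gamma>"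
    using assms(1,3) open_contains_ball by blast
  define T where "T = max 1 (2 * norm \<xi> / e)"
  have "(t *\<^sub>R x0, \<xi>) \<in> \<Gamma>" if "T \<le> t" for t
  proof -
    have "1 \<le> t" "2 * norm \<xi> / e \<le> t"
      using that by (auto simp: T_def)
    moreover have "0 < e * t"
      using \<open>0 < e\<close> \<open>1 \<le> t\<close> by simp
    moreover have "2 * norm \<xi> \<le> e * t"
      using \<open>2 * norm \<xi> / e \<le> t\<close> \<open>0 < e\<close> by (simp add: divide_le_eq mult.commute)
    ultimately have "norm \<xi> < e * t"
      by linarith
    then have "norm \<xi> / t < e"
      using \<open>1 \<le> t\<close> by (simp add: divide_less_eq mult.commute)
    then have "(x0, (1 / t) *\<^sub>R \<xi>) \<in> ball (x0, 0) e"
      using \<open>1 \<le> t\<close> by (simp add: dist_Pair_Pair dist_norm)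
    then have "(x0, (1 / t) *\<^sub>R \<xi>) \<in> \<Gamma>"
      using e by blast
    moreover have "0 < t"
      using \<open>1 \<le> t\<close> by simp
    ultimately have "t *\<^sub>R (x0, (1 / t) *\<^sub>R \<xi>) \<in> \<Gamma>"
      using assms(2) unfolding conic_def by blast
    then show ?thesis
      using \<open>1 \<le> t\<close> by simp
  qed
  then show ?thesis
    by (intro exI[of _ T]) (auto simp: T_def)
qed

section \<open>The short-time Fourier transform of the Gaussian\<close>

locale gauss_stft = psd_matrix A for A :: "real^'n^'n" +
  fixes \<phi> :: "real^'n \<Rightarrow> complex"
  assumes window: "schwartz \<phi>"
begin

definition gauss :: "real^'n \<Rightarrow> complex" where
  "gauss y = complex_of_real (exp (- qf y))"

lemma norm_gauss_le_1: "norm (gauss y) \<le> 1"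
  using qf_nonneg[of y] by (simp add: gauss_def)

lemma continuous_on_gauss: "continuous_on S gauss"
  unfolding gauss_def by (intro continuous_intros)

lemmas continuous_on_window = schwartz_continuous_on[OF window]
lemmas integrable_window = integrable_schwartz[OF window]

lemma window_measurable [measurable]: "\<phi> \<in> borel_measurable borel"
  by (rule schwartz_measurable[OF window])

lemma integrable_gauss_mult_window: "integrable lborel (\<lambda>y. gauss y * cnj (\<phi> (y - x)))"
proof (rule Bochner_Integration.integrable_bound)
  have "integrable lborel (\<lambda>y. \<phi> (y + (- x)))"
    using integrable_window by (subst integrable_lborel_translate_iff) auto
  then show "integrable lborel (\<lambda>y. norm (\<phi> (y - x)))"
    by simp
  have "continuous_on UNIV (\<lambda>y. gauss y * cnj (\<phi> (y - x)))"
    by (intro continuous_intros continuous_on_gauss continuous_on_compose2[OF continuous_on_window]) auto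
  then show "(\<lambda>y. gauss y * cnj (\<phi> (y - x))) \<in> borel_measurable lborel"
    by (simp add: borel_measurable_continuous_onI)
  show "AE y in lborel. norm (gauss y * cnj (\<phi> (y - x))) \<le> norm (norm (\<phi> (y - x)))"
    using norm_gauss_le_1 by (auto simp: norm_mult intro!: mult_left_le_one_le)
qed

lemma norm_stft_le_integral:
  "norm (stft \<phi> gauss (x, \<xi>)) \<le> (\<integral>y. norm (gauss y) * norm (\<phi> (y - x)) \<partial>lborel)"
proof -
  have "norm (stft \<phi> gauss (x, \<xi>))
      \<le> (\<integral>y. norm (gauss y * cnj (\<phi> (y - x)) * exp (- \<i> * complex_of_real (y \<bullet> \<xi>))) \<partial>lborel)"
    unfolding stft_def by (simp add: integral_norm_bound)
  then show ?thesis
    by (simp add: norm_mult)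
qed

lemma norm_stft_le_L1: "norm (stft \<phi> gauss z) \<le> (\<integral>y. norm (\<phi> y) \<partial>lborel)"
proof -
  obtain x \<xi> where z: "z = (x, \<xi>)"
    by force
  have "norm (stft \<phi> gauss z) \<le> (\<integral>y. norm (gauss y) * norm (\<phi> (y - x)) \<partial>lborel)"
    unfolding z by (rule norm_stft_le_integral)
  also have "\<dots> \<le> (\<integral>y. norm (\<phi> (y + (- x))) \<partial>lborel)"
  proof (rule integral_mono)
    show "integrable lborel (\<lambda>y. norm (gauss y) * norm (\<phi> (y - x)))"
      using integrable_norm[OF integrable_gauss_mult_window[of x]] by (simp add: norm_mult)
    show "integrable lborel (\<lambda>y. norm (\<phi> (y + - x)))"
      using integrable_window by (subst integrable_lborel_translate_iff) (auto simp: integrable_norm)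
    show "norm (gauss y) * norm (\<phi> (y - x)) \<le> norm (\<phi> (y + - x))" for y
      using norm_gauss_le_1[of y] by (simp add: mult_left_le_one_le)
  qed
  also have "\<dots> = (\<integral>y. norm (\<phi> y) \<partial>lborel)"
    by (rule lborel_integral_translate[where f="\<lambda>y. norm (\<phi> y)"]) measurable
  finally show ?thesis .
qed

context
  fixes b :: "real^'n"
begin

text \<open>The derivative of \<open>p (bf b y) exp (- qf y)\<close> along \<open>b\<close> is \<open>(qf b p' - 2 X p) (bf b y) exp (- qf y)\<close>.\<close>

primrec gauss_poly :: "nat \<Rightarrow> real poly" where
  "gauss_poly 0 = 1"
| "gauss_poly (Suc j) = smult (qf b) (pderiv (gauss_poly j)) - [:0, 2:] * gauss_poly j"

definition gauss_deriv :: "nat \<Rightarrow> real^'n \<Rightarrow> complex" where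
  "gauss_deriv j y = complex_of_real (poly (gauss_poly j) (bf b y) * exp (- qf y))"

lemma gauss_deriv_has_vector_derivative:
  "((\<lambda>s. gauss_deriv j (y + s *\<^sub>R b)) has_vector_derivative gauss_deriv (Suc j) y) (at 0)"
proof -
  have bf_line: "bf b (y + s *\<^sub>R b) = bf b y + s * qf b" for s
    by (simp add: bf_def qf_def matrix_vector_right_distrib matrix_vector_mult_scaleR inner_add_right)
  have qf_line: "qf (y + s *\<^sub>R b) = qf y + 2 * s * bf b y + s\<^sup>2 * qf b" for s
    using qf_add[of y "s *\<^sub>R b"] by (simp add: qf_scaleR bf_scaleR_right bf_commute[of y b])
  have d1: "((\<lambda>s. poly (gauss_poly j) (bf b y + s * qf b)) has_real_derivative
      poly (pderiv (gauss_poly j)) (bf b y + 0 * qf b) * qf b) (at 0)"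
    by (rule DERIV_chain2[OF poly_DERIV]) (auto intro!: derivative_eq_intros)
  have d2: "((\<lambda>s. exp (- (qf y + 2 * s * bf b y + s\<^sup>2 * qf b))) has_real_derivative
      exp (- (qf y + 2 * 0 * bf b y + 0\<^sup>2 * qf b)) * (- (2 * bf b y))) (at 0)"
    by (auto intro!: derivative_eq_intros)
  have "((\<lambda>s. poly (gauss_poly j) (bf b y + s * qf b) * exp (- (qf y + 2 * s * bf b y + s\<^sup>2 * qf b)))
      has_real_derivative poly (gauss_poly (Suc j)) (bf b y) * exp (- qf y)) (at 0)"
    using DERIV_mult[OF d1 d2] by (simp add: algebra_simps)
  then show ?thesis
    unfolding gauss_deriv_def bf_line qf_line by (rule has_vector_derivative_of_real)
qed

lemma dir_deriv_chain_gauss_deriv: "dir_deriv_chain b gauss_deriv"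
proof (rule dir_deriv_chainI)
  show "((\<lambda>s. gauss_deriv j (y + s *\<^sub>R b)) has_vector_derivative gauss_deriv (Suc j) y) (at 0)" for j y
    by (rule gauss_deriv_has_vector_derivative)
  show "continuous_on UNIV (gauss_deriv j)" for j
    unfolding gauss_deriv_def bf_def by (intro continuous_intros linear_continuous_on) auto
qed

lemma gauss_deriv_bounded: "\<exists>C. \<forall>y. norm (gauss_deriv j y) \<le> C"
proof (intro exI allI)
  fix y
  let ?c = "\<Sum>i\<le>degree (gauss_poly j). \<bar>coeff (gauss_poly j) i\<bar>"
  let ?d = "degree (gauss_poly j)"
  have "0 \<le> ?c"
    by (intro sum_nonneg) auto
  have "qf b * qf y \<le> (qf b + qf y)\<^sup>2"
    using qf_nonneg[of b] qf_nonneg[of y] by (simp add: power2_eq_square algebra_simps)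
  then have "\<bar>bf b y\<bar>\<^sup>2 \<le> (qf b + qf y)\<^sup>2"
    using bf_square_le[of b y] by simp
  then have "\<bar>bf b y\<bar> \<le> qf b + qf y"
    by (rule power2_le_imp_le) (use qf_nonneg[of b] qf_nonneg[of y] in simp)
  then have "(1 + \<bar>bf b y\<bar>) ^ ?d \<le> ((1 + qf b) + qf y) ^ ?d"
    by (intro power_mono) auto
  then have "\<bar>poly (gauss_poly j) (bf b y)\<bar> \<le> ?c * ((1 + qf b) + qf y) ^ ?d"
    using abs_poly_le[of "gauss_poly j" "bf b y"] \<open>0 \<le> ?c\<close> by (meson mult_left_mono order_trans)
  then have "\<bar>poly (gauss_poly j) (bf b y)\<bar> * exp (- qf y) \<le> ?c * (((1 + qf b) + qf y) ^ ?d * exp (- qf y))"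
    by (simp add: mult_right_mono mult.assoc)
  also have "\<dots> \<le> ?c * (fact ?d * exp (1 + qf b))"
    using \<open>0 \<le> ?c\<close> qf_nonneg[of b] qf_nonneg[of y] by (intro mult_left_mono add_power_mult_exp_neg_le) auto
  finally show "norm (gauss_deriv j y) \<le> ?c * (fact ?d * exp (1 + qf b))"
    by (simp add: gauss_deriv_def norm_mult)
qed

definition window_deriv :: "real^'n \<Rightarrow> nat \<Rightarrow> real^'n \<Rightarrow> complex" where
  "window_deriv x j y = cnj (iter_pd (replicate j b) \<phi> (y - x))"

definition window_deriv_L1 :: "nat \<Rightarrow> real" where
  "window_deriv_L1 j = (\<integral>y. norm (iter_pd (replicate j b) \<phi> y) \<partial>lborel)"

context
  assumes b: "b \<in> Basis"
begin

lemma window_deriv_has_vector_derivative: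
  "((\<lambda>s. window_deriv x j (y + s *\<^sub>R b)) has_vector_derivative window_deriv x (Suc j) y) (at 0)"
proof -
  let ?f = "iter_pd (replicate j b) \<phi>"
  let ?D = "frechet_derivative ?f (at (y - x))"
  have "?f differentiable (at (y - x))"
    using b by (intro schwartz_iter_pd_differentiable[OF window]) auto
  then have D: "(?f has_derivative ?D) (at (y - x))"
    by (simp add: frechet_derivative_works)
  have line: "((\<lambda>s. (y - x) + s *\<^sub>R b) has_derivative (\<lambda>s. s *\<^sub>R b)) (at 0)"
    by (auto intro!: derivative_eq_intros)
  have "((\<lambda>s. ?f ((y - x) + s *\<^sub>R b)) has_derivative (\<lambda>s. ?D (s *\<^sub>R b))) (at 0)"
    using has_derivative_compose[OF line, of ?f ?D] D by simp
  moreover have "(\<lambda>s. ?D (s *\<^sub>R b)) = (\<lambda>s. s *\<^sub>R ?D b)"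
    using has_derivative_bounded_linear[OF D] by (simp add: bounded_linear.linear linear_cmul)
  ultimately have "((\<lambda>s. ?f ((y - x) + s *\<^sub>R b)) has_vector_derivative ?D b) (at 0)"
    by (simp add: has_vector_derivative_def)
  then have "((\<lambda>s. cnj (?f ((y - x) + s *\<^sub>R b))) has_vector_derivative cnj (?D b)) (at 0)"
    by (rule has_vector_derivative_cnj)
  then show ?thesis
    by (simp add: window_deriv_def diff_add_eq)
qed

lemma dir_deriv_chain_window_deriv: "dir_deriv_chain b (window_deriv x)"
proof (rule dir_deriv_chainI)
  show "((\<lambda>s. window_deriv x j (y + s *\<^sub>R b)) has_vector_derivative window_deriv x (Suc j) y) (at 0)" for j y
    by (rule window_deriv_has_vector_derivative)
  fix j
  have "continuous_on UNIV (iter_pd (replicate j b) \<phi>)"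
    using b by (intro schwartz_iter_pd_continuous_on[OF window]) auto
  then have "continuous_on UNIV (\<lambda>y. iter_pd (replicate j b) \<phi> (y - x))"
    by (rule continuous_on_compose2) (auto intro: continuous_intros)
  then show "continuous_on UNIV (window_deriv x j)"
    unfolding window_deriv_def by (intro continuous_intros)
qed

lemma nn_integral_window_deriv:
  "(\<integral>\<^sup>+y. norm (window_deriv x j y) \<partial>lborel) = ennreal (window_deriv_L1 j)"
proof -
  have vs: "set (replicate j b) \<subseteq> Basis"
    using b by auto
  have [measurable]: "iter_pd (replicate j b) \<phi> \<in> borel_measurable borel"
    by (rule schwartz_iter_pd_measurable[OF window vs])
  have "(\<integral>\<^sup>+y. norm (window_deriv x j y) \<partial>lborel) = (\<integral>\<^sup>+y. norm (iter_pd (replicate j b) \<phi> y) \<partial>lborel)"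
    unfolding window_deriv_def complex_mod_cnj by (rule lborel_nn_integral_norm_translate) measurable
  also have "\<dots> = ennreal (window_deriv_L1 j)"
    unfolding window_deriv_L1_def
    using integrable_schwartz_iter_pd_weighted[OF window vs, of 0] by (intro nn_integral_eq_integral) auto
  finally show ?thesis .
qed

lemma stft_eq_fourier: "stft \<phi> gauss (x, \<xi>) = fourier (\<lambda>y. gauss_deriv 0 y * window_deriv x 0 y) \<xi>"
  by (simp add: stft_def fourier_def gauss_deriv_def window_deriv_def gauss_def)

lemma stft_freq_decay:
  "\<exists>C. 0 \<le> C \<and> (\<forall>x \<xi>. \<xi> \<bullet> b \<noteq> 0 \<longrightarrow> norm (stft \<phi> gauss (x, \<xi>)) \<le> C * (1 / \<bar>\<xi> \<bullet> b\<bar>) ^ K)"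
proof -
  obtain M where M: "0 \<le> M" "\<And>j y. j \<le> K \<Longrightarrow> norm (gauss_deriv j y) \<le> M"
    using uniform_bound_upto[of "\<lambda>j y. norm (gauss_deriv j y)" K] gauss_deriv_bounded by blast
  define L where "L = (\<Sum>j\<le>K. window_deriv_L1 j)"
  have L0: "0 \<le> L"
    unfolding L_def window_deriv_L1_def by (intro sum_nonneg) simp
  have L: "(\<integral>\<^sup>+y. norm (window_deriv x j y) \<partial>lborel) \<le> ennreal L" if "j \<le> K" for x j
    unfolding nn_integral_window_deriv L_def window_deriv_L1_def using that
    by (intro ennreal_leI member_le_sum[where f="window_deriv_L1", unfolded window_deriv_L1_def]) auto
  have "norm (stft \<phi> gauss (x, \<xi>)) \<le> pi ^ K * M * L * (1 / \<bar>\<xi> \<bullet> b\<bar>) ^ K" if "\<xi> \<bullet> b \<noteq> 0" for x \<xi>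
  proof -
    have "integrable lborel (\<lambda>y. gauss_deriv 0 y * window_deriv x 0 y)"
      using integrable_gauss_mult_window[of x] by (simp add: gauss_deriv_def window_deriv_def gauss_def)
    then have "norm (stft \<phi> gauss (x, \<xi>)) \<le> (pi / \<bar>\<xi> \<bullet> b\<bar>) ^ K * M * L"
      unfolding stft_eq_fourier
      by (intro norm_fourier_mult_le[OF dir_deriv_chain_gauss_deriv dir_deriv_chain_window_deriv
            M(2) L M(1) L0 _ that])
    then show ?thesis
      by (simp add: power_divide)
  qed
  then show ?thesis
    using M(1) L0 by (intro exI[of _ "pi ^ K * M * L"]) auto
qed

end

end

lemma stft_cone_decay_off_kernel:
  assumes "0 < c"
  shows "\<exists>C. \<forall>z. c * (norm z)\<^sup>2 \<le> qf (fst z) \<longrightarrow> (1 + (norm z)\<^sup>2) ^ K * norm (stft \<phi> gauss z) \<le> C"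
proof -
  define C1 where "C1 = (2 / c) ^ K * (fact K * exp (c / 2)) * (1 + 2 / c * onorm ((*v) A)) ^ K"
  define I where "I = (\<integral>w. (1 + (norm w)\<^sup>2) ^ K * norm (\<phi> w) \<partial>lborel)"
  have int: "integrable lborel (\<lambda>w. (1 + (norm w)\<^sup>2) ^ K * norm (\<phi> w))"
    using integrable_schwartz_iter_pd_weighted[OF window, of "[]" K] by simp
  have "(1 + (norm z)\<^sup>2) ^ K * norm (stft \<phi> gauss z) \<le> C1 * I"
    if cone: "c * (norm z)\<^sup>2 \<le> qf (fst z)" for z
  proof -
    obtain x \<xi> where z: "z = (x, \<xi>)"
      by force
    let ?Z = "(norm z)\<^sup>2"
    have "(1 + ?Z) ^ K * norm (stft \<phi> gauss z) \<le> (1 + ?Z) ^ K * (\<integral>y. norm (gauss y) * norm (\<phi> (y - x)) \<partial>lborel)"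
      unfolding z by (intro mult_left_mono norm_stft_le_integral) auto
    also have "\<dots> = (\<integral>y. (1 + ?Z) ^ K * (norm (gauss y) * norm (\<phi> (y - x))) \<partial>lborel)"
      by simp
    also have "\<dots> \<le> (\<integral>y. C1 * ((1 + (norm (y + - x))\<^sup>2) ^ K * norm (\<phi> (y + - x))) \<partial>lborel)"
    proof (rule integral_mono)
      show "integrable lborel (\<lambda>y. (1 + ?Z) ^ K * (norm (gauss y) * norm (\<phi> (y - x))))"
        using integrable_norm[OF integrable_gauss_mult_window[of x]] by (simp add: norm_mult)
      show "integrable lborel (\<lambda>y. C1 * ((1 + (norm (y + - x))\<^sup>2) ^ K * norm (\<phi> (y + - x))))"
        using int by (subst integrable_lborel_translate_iff) auto
      fix y
      have "(1 + ?Z) ^ K * norm (gauss y) \<le> C1 * (1 + (norm (y - x))\<^sup>2) ^ K"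
        using cone_weight_mult_exp_le[where y=y and K=K, OF \<open>0 < c\<close> _ cone[unfolded z fst_conv]]
        by (simp add: gauss_def C1_def z)
      then show "(1 + ?Z) ^ K * (norm (gauss y) * norm (\<phi> (y - x)))
          \<le> C1 * ((1 + (norm (y + - x))\<^sup>2) ^ K * norm (\<phi> (y + - x)))"
        by (simp add: mult_right_mono mult.assoc[symmetric])
    qed
    also have "\<dots> = C1 * (\<integral>y. (1 + (norm (y + - x))\<^sup>2) ^ K * norm (\<phi> (y + - x)) \<partial>lborel)"
      by (rule integral_mult_right_zero)
    also have "(\<integral>y. (1 + (norm (y + - x))\<^sup>2) ^ K * norm (\<phi> (y + - x)) \<partial>lborel) = I"
      unfolding I_def by (rule lborel_integral_translate) measurable
    finally show ?thesis .
  qed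
  then show ?thesis
    by blast
qed

lemma not_in_gabor_WF_nonzero_freq:
  assumes "\<xi>0 \<noteq> 0"
  shows "(x0, \<xi>0) \<notin> gabor_WF \<phi> gauss"
proof -
  obtain b :: "real^'n" where b: "b \<in> Basis" "\<xi>0 \<bullet> b \<noteq> 0"
    using assms euclidean_all_zero_iff[of \<xi>0] by blast
  define c where "c = \<bar>\<xi>0 \<bullet> b\<bar> / (2 * norm (x0, \<xi>0))"
  have "0 < norm (x0, \<xi>0)"
    using assms by (simp add: zero_prod_def)
  then have "0 < c"
    using b by (simp add: c_def)
  show ?thesis
  proof (rule not_in_gabor_WF_if_decay[where \<Gamma>="{z. c * norm z < \<bar>snd z \<bullet> b\<bar>}"])
    show "(x0, \<xi>0) \<noteq> 0"
      using assms by (simp add: zero_prod_def)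
    show "open {z :: (real^'n) \<times> (real^'n). c * norm z < \<bar>snd z \<bullet> b\<bar>}"
      by (intro open_Collect_less continuous_intros)
    show "conic {z :: (real^'n) \<times> (real^'n). c * norm z < \<bar>snd z \<bullet> b\<bar>}"
      unfolding conic_def by (auto simp: abs_mult)
    show "(x0, \<xi>0) \<in> {z. c * norm z < \<bar>snd z \<bullet> b\<bar>}"
      using b \<open>0 < norm (x0, \<xi>0)\<close> by (simp add: c_def)
    fix K :: nat
    obtain C where "0 \<le> C" and C: "\<And>x \<xi>. \<xi> \<bullet> b \<noteq> 0 \<Longrightarrow> norm (stft \<phi> gauss (x, \<xi>)) \<le> C * (1 / \<bar>\<xi> \<bullet> b\<bar>) ^ (2 * K)"
      using stft_freq_decay[OF b(1), of "2 * K"] by blast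
    have "\<exists>D. \<forall>z. c * norm z < \<bar>snd z \<bullet> b\<bar> \<longrightarrow> (1 + (norm z)\<^sup>2) ^ K * norm (stft \<phi> gauss z) \<le> D"
      using C \<open>0 \<le> C\<close> norm_stft_le_L1
      by (intro power_decay_in_cone[OF \<open>0 < c\<close>]) (auto simp: split_paired_all)
    then show "\<exists>D. \<forall>z\<in>{z. c * norm z < \<bar>snd z \<bullet> b\<bar>}. (1 + (norm z)\<^sup>2) ^ K * norm (stft \<phi> gauss z) \<le> D"
      by auto
  qed auto
qed

lemma not_in_gabor_WF_off_kernel:
  assumes "A *v x0 \<noteq> 0"
  shows "(x0, 0) \<notin> gabor_WF \<phi> gauss"
proof -
  have "0 < qf x0" "x0 \<noteq> 0"
    using assms qf_pos_off_kernel by auto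
  define c where "c = qf x0 / (2 * (norm x0)\<^sup>2)"
  have "0 < c"
    using \<open>0 < qf x0\<close> \<open>x0 \<noteq> 0\<close> by (simp add: c_def)
  show ?thesis
  proof (rule not_in_gabor_WF_if_decay[where \<Gamma>="{z. c * (norm z)\<^sup>2 < qf (fst z)}"])
    show "(x0, 0) \<noteq> 0"
      using \<open>x0 \<noteq> 0\<close> by (simp add: zero_prod_def)
    show "open {z :: (real^'n) \<times> (real^'n). c * (norm z)\<^sup>2 < qf (fst z)}"
      by (intro open_Collect_less continuous_intros continuous_on_compose2[OF continuous_on_qf]) auto
    show "conic {z :: (real^'n) \<times> (real^'n). c * (norm z)\<^sup>2 < qf (fst z)}"
      unfolding conic_def by (auto simp: qf_scaleR power_mult_distrib)
    show "0 \<notin> {z :: (real^'n) \<times> (real^'n). c * (norm z)\<^sup>2 < qf (fst z)}"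
      by (simp add: qf_def)
    show "(x0, 0) \<in> {z. c * (norm z)\<^sup>2 < qf (fst z)}"
      using \<open>0 < qf x0\<close> \<open>x0 \<noteq> 0\<close> by (simp add: c_def)
    fix K :: nat
    show "\<exists>C. \<forall>z\<in>{z. c * (norm z)\<^sup>2 < qf (fst z)}. (1 + (norm z)\<^sup>2) ^ K * norm (stft \<phi> gauss z) \<le> C"
      using stft_cone_decay_off_kernel[OF \<open>0 < c\<close>, of K] by (auto intro: less_imp_le)
  qed
qed

lemma gabor_WF_subset_kernel: "gabor_WF \<phi> gauss \<subseteq> {(x, 0) | x. A *v x = 0 \<and> x \<noteq> 0}"
proof
  fix z assume z: "z \<in> gabor_WF \<phi> gauss"
  obtain x \<xi> where zz: "z = (x, \<xi>)"
    by force
  have "\<xi> = 0"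
    using not_in_gabor_WF_nonzero_freq z zz by blast
  moreover have "A *v x = 0"
    using not_in_gabor_WF_off_kernel z zz \<open>\<xi> = 0\<close> by blast
  moreover have "z \<noteq> 0"
    using z by (simp add: gabor_WF_def)
  ultimately show "z \<in> {(x, 0) | x. A *v x = 0 \<and> x \<noteq> 0}"
    using zz by (auto simp: zero_prod_def)
qed

lemma stft_origin_nonvanishing:
  assumes "\<phi> \<noteq> (\<lambda>_. 0)"
  shows "\<exists>\<xi>. stft \<phi> gauss (0, \<xi>) \<noteq> 0"
proof (rule ccontr)
  assume "\<nexists>\<xi>. stft \<phi> gauss (0, \<xi>) \<noteq> 0"
  define h where "h = (\<lambda>y. gauss y * cnj (\<phi> y))"
  have "fourier h \<xi> = stft \<phi> gauss (0, \<xi>)" for \<xi>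
    by (simp add: fourier_def stft_def h_def)
  then have zero: "fourier h \<xi> = 0" for \<xi>
    using \<open>\<nexists>\<xi>. stft \<phi> gauss (0, \<xi>) \<noteq> 0\<close> by simp
  have cont: "continuous_on UNIV h"
    unfolding h_def by (intro continuous_intros continuous_on_gauss continuous_on_window)
  have int: "integrable lborel h"
    using integrable_gauss_mult_window[of 0] by (simp add: h_def)
  obtain B where B: "\<And>y. norm (\<phi> y) \<le> B"
    using schwartz_bounded[OF window] by blast
  have "norm (h y) \<le> 1 * B" for y
    unfolding h_def norm_mult complex_mod_cnj using norm_gauss_le_1 B by (intro mult_mono) auto
  then have bounded: "norm (h y) \<le> B" for y
    by simp
  have "h y = 0" for y
    by (rule fourier_eq_zero_imp_eq_zero[OF cont bounded int zero])
  then have "\<phi> y = 0" for y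
    by (simp add: h_def gauss_def)
  then show False
    using assms by auto
qed

lemma norm_stft_translate_kernel:
  assumes "A *v w = 0"
  shows "norm (stft \<phi> gauss (x + w, \<xi>)) = norm (stft \<phi> gauss (x, \<xi>))"
proof -
  define g where "g = (\<lambda>y. gauss y * cnj (\<phi> (y - (x + w))) * exp (- \<i> * complex_of_real (y \<bullet> \<xi>)))"
  have "continuous_on UNIV g"
    unfolding g_def
    by (intro continuous_intros continuous_on_gauss continuous_on_compose2[OF continuous_on_window]) auto
  then have [measurable]: "g \<in> borel_measurable borel"
    by (rule borel_measurable_continuous_onI)
  have g_shift: "g (y + w) = exp (- \<i> * complex_of_real (w \<bullet> \<xi>))
      * (gauss y * cnj (\<phi> (y - x)) * exp (- \<i> * complex_of_real (y \<bullet> \<xi>)))" for y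
  proof -
    have "gauss (y + w) = gauss y"
      by (simp add: gauss_def qf_add_kernel[OF assms])
    moreover have "exp (- \<i> * complex_of_real ((y + w) \<bullet> \<xi>))
        = exp (- \<i> * complex_of_real (w \<bullet> \<xi>)) * exp (- \<i> * complex_of_real (y \<bullet> \<xi>))"
      by (simp add: inner_add_left distrib_left exp_add[symmetric] add.commute)
    ultimately show ?thesis
      by (simp add: g_def mult_ac)
  qed
  have "stft \<phi> gauss (x + w, \<xi>) = (\<integral>y. g y \<partial>lborel)"
    by (simp add: stft_def g_def)
  also have "\<dots> = (\<integral>y. g (y + w) \<partial>lborel)"
    by (rule lborel_integral_translate[symmetric]) measurable
  also have "\<dots> = exp (- \<i> * complex_of_real (w \<bullet> \<xi>)) * stft \<phi> gauss (x, \<xi>)"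
    by (simp only: g_shift integral_mult_right_zero) (simp add: stft_def)
  finally show ?thesis
    by (simp add: norm_mult)
qed

lemma stft_unbounded_near_kernel:
  assumes "\<phi> \<noteq> (\<lambda>_. 0)" and kernel: "A *v x0 = 0" and "x0 \<noteq> 0"
    and nbhd: "open \<Gamma>" "conic \<Gamma>" "(x0, 0) \<in> \<Gamma>"
  shows "\<not> (\<exists>C. \<forall>z\<in>\<Gamma>. jbr z powr 1 * norm (stft \<phi> gauss z) \<le> C)"
proof
  assume "\<exists>C. \<forall>z\<in>\<Gamma>. jbr z powr 1 * norm (stft \<phi> gauss z) \<le> C"
  then obtain C where C: "\<And>z. z \<in> \<Gamma> \<Longrightarrow> jbr z powr 1 * norm (stft \<phi> gauss z) \<le> C"
    by blast
  obtain \<xi> where "stft \<phi> gauss (0, \<xi>) \<noteq> 0"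
    using stft_origin_nonvanishing[OF assms(1)] by blast
  define v where "v = norm (stft \<phi> gauss (0, \<xi>))"
  have "0 < v" "0 < norm x0"
    using \<open>stft \<phi> gauss (0, \<xi>) \<noteq> 0\<close> \<open>x0 \<noteq> 0\<close> by (auto simp: v_def)
  obtain T where "0 < T" and T: "\<And>t. T \<le> t \<Longrightarrow> (t *\<^sub>R x0, \<xi>) \<in> \<Gamma>"
    using open_conic_contains_shifted_line[OF nbhd] by blast
  define t where "t = max T ((\<bar>C\<bar> + 1) / (norm x0 * v))"
  have "t * norm x0 \<le> norm (t *\<^sub>R x0, \<xi>)"
    using \<open>0 < T\<close> by (simp add: t_def norm_Pair real_sqrt_sum_squares_ge1)
  also have "\<dots> \<le> jbr (t *\<^sub>R x0, \<xi>)"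
    unfolding jbr_def by (rule real_le_rsqrt) simp
  finally have "t * norm x0 * v \<le> jbr (t *\<^sub>R x0, \<xi>) * v"
    using \<open>0 < v\<close> by (intro mult_right_mono) auto
  also have "\<dots> = jbr (t *\<^sub>R x0, \<xi>) powr 1 * norm (stft \<phi> gauss (t *\<^sub>R x0, \<xi>))"
    using norm_stft_translate_kernel[of "t *\<^sub>R x0" 0 \<xi>] kernel one_le_jbr[of "(t *\<^sub>R x0, \<xi>)"]
    by (simp add: v_def matrix_vector_mult_scaleR)
  also have "\<dots> \<le> C"
    by (rule C[OF T]) (simp add: t_def)
  finally have "t * norm x0 * v \<le> C" .
  moreover have "(\<bar>C\<bar> + 1) / (norm x0 * v) \<le> t"
    by (simp add: t_def)
  then have "\<bar>C\<bar> + 1 \<le> t * (norm x0 * v)"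
    using \<open>0 < v\<close> \<open>0 < norm x0\<close> by (simp add: pos_divide_le_eq)
  ultimately show False
    by (simp add: mult_ac)
qed

lemma kernel_in_gabor_WF:
  assumes "\<phi> \<noteq> (\<lambda>_. 0)" and "A *v x0 = 0" and "x0 \<noteq> 0"
  shows "(x0, 0) \<in> gabor_WF \<phi> gauss"
proof -
  have "(x0, 0) \<noteq> (0 :: (real^'n) \<times> (real^'n))"
    using \<open>x0 \<noteq> 0\<close> by (simp add: zero_prod_def)
  then show ?thesis
    using stft_unbounded_near_kernel[OF assms] unfolding gabor_WF_def by (blast intro: zero_le_one)
qed

end

theorem mainTheorem11:
  fixes A :: "real^'n^'n" and \<phi> :: "real^'n \<Rightarrow> complex"
  assumes "transpose A = A"
    and "\<forall>x. 0 \<le> x \<bullet> (A *v x)"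
    and "schwartz \<phi>" and "\<phi> \<noteq> (\<lambda>_. 0)"
  shows "gabor_WF \<phi> (\<lambda>y. complex_of_real (exp (- (y \<bullet> (A *v y)))))
           = {(x, 0) | x. A *v x = 0 \<and> x \<noteq> 0}"
proof -
  interpret gauss_stft A \<phi>
    using assms by unfold_locales auto
  have "(\<lambda>y. complex_of_real (exp (- (y \<bullet> (A *v y))))) = gauss"
    by (simp add: gauss_def[abs_def] qf_def)
  then show ?thesis
    using gabor_WF_subset_kernel kernel_in_gabor_WF[OF assms(4)] by (simp only:) blast
qed

end
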